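(* Let $c\ge1$ and $v_0=\sqrt{c^2+|v|^2}$. For any smooth functions $h,f$ on $\mathbb{R}^3$ and $j=1,2,3$, the relativistic Boltzmann operator $Q_c$ satisfies $$\partial_{v_j}Q_c(h,f)=\frac1{v_0}Q_c\big(h,\,v_0\partial_{v_j}f\big)+\frac1{v_0}Q_c\big(v_0\partial_{v_j}h,\,f\big)-\frac{v_j}{v_0^2}Q_c(h,f).$$
   Context: $c\ge 1$ is the speed of light. For $v\in\mathbb{R}^3$ put $v_0=\sqrt{c^2+|v|^2}$ (similarly $u_0,v_0',u_0'$). The relativistic Boltzmann collision operator is $$Q_c(h,f)(v)=\int_{\mathbb{R}^3}\int_{\mathbb{S}^2}B_c(v,u)\big(h(u')f(v')-h(u)f(v)\big)\,d\omega\,du,$$ where $g=\sqrt{2(v_0u_0-v\cdot u-c^2)}$, $s=2(v_0u_0-v\cdot u+c^2)=g^2+4c^2$, $B_c(v,u)=v_\phi\,\sigma(g,\vartheta)$, $v_\phi=\frac{cg\sqrt s}{4v_0u_0}$, $\sigma(g,\vartheta)=|g|^{\gamma-1}\sigma_0(\vartheta)$ with $\sigma_0$ nonnegative and bounded (the paper works with $\gamma\in(-2,0]$), the post-collisional momenta are $$v'=\frac{v+u}2+\frac g2\left(\omega+(v+u)\frac{(v+u)\cdot\omega}{\sqrt s(v_0+u_0+\sqrt s)}\right),\quad u'=\frac{v+u}2-\frac g2\left(\omega+(v+u)\frac{(v+u)\cdot\omega}{\sqrt s(v_0+u_0+\sqrt s)}\right),$$ and $\cos\vartheta=\frac{-(v_0-u_0)(v_0'-u_0')+(v-u)\cdot(v'-u')}{g^2}$.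 Here $v_0\partial_{v_j}f$ denotes the function $v\mapsto v_0\,\partial_{v_j}f(v)$. Smooth functions are implicitly taken with enough decay (together with their derivatives) for all integrals to converge. *)

theory Defs
  imports "HOL-Analysis.Analysis"
begin

section \<open>Smooth functions and partial derivatives on $R^3$\<close>

definition partial :: "3 \<Rightarrow> (real^3 \<Rightarrow> real) \<Rightarrow> real^3 \<Rightarrow> real" where
  "partial j f v = deriv (\<lambda>t. f (v + t *\<^sub>R axis j 1)) 0"

primrec C_k :: "nat \<Rightarrow> (real^3 \<Rightarrow> real) \<Rightarrow> bool" where
  "C_k 0 f \<longleftrightarrow> continuous_on UNIV f"
| "C_k (Suc n) f \<longleftrightarrow> (\<forall>v. f differentiable (at v)) \<and> (\<forall>j. C_k n (partial j f))"

definition smooth :: "(real^3 \<Rightarrow> real) \<Rightarrow> bool" where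
  "smooth f \<longleftrightarrow> (\<forall>n. C_k n f)"

section \<open>Surface measure on the unit sphere\<close>

text \<open>
  Surface measure on the unit sphere, in its standard construction from polar coordinates:
  the measure of \<open>A\<close> is 3 times the Lebesgue measure of the cone
  \<open>{r x | 0 < r < 1, x \<in> A}\<close>. The function \<open>sgn x\<close> is \<open>x / |x|\<close>.
\<close>

definition sphere_measure :: "(real^3) measure" where
  "sphere_measure = scale_measure 3
     (distr (restrict_space lborel (ball 0 1 - {0})) (restrict_space borel (sphere 0 1)) sgn)"

lemma space_sphere_measure: "space sphere_measure = sphere 0 1"
  by (simp add: sphere_measure_def space_scale_measure space_restrict_space)

lemma emeasure_sphere_measure_space: "emeasure sphere_measure (sphere 0 1) = ennreal (4 * pi)"
proof -
  let ?M = "restrict_space lborel (ball 0 1 - {0 :: real^3})"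
  let ?N = "restrict_space borel (sphere 0 1 :: (real^3) set)"
  have sgn_borel: "(sgn :: real^3 \<Rightarrow> real^3) \<in> borel \<rightarrow>\<^sub>M borel"
    unfolding sgn_div_norm[abs_def] by measurable
  have sgn_meas: "sgn \<in> ?M \<rightarrow>\<^sub>M ?N"
  proof (rule measurable_restrict_space2)
    show "sgn \<in> space ?M \<rightarrow> sphere 0 1"
      by (auto simp: space_restrict_space norm_sgn)
    show "sgn \<in> borel_measurable ?M"
      by (rule measurable_restrict_space1) (use sgn_borel in simp)
  qed
  have vol: "emeasure lborel (ball 0 1 - {0 :: real^3}) = ennreal (4 / 3 * pi)"
  proof -
    have "emeasure lborel (ball 0 1 - {0 :: real^3}) =
        emeasure lborel (ball 0 1 :: (real^3) set) - emeasure lborel {0 :: real^3}"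
      by (rule emeasure_Diff) auto
    also have "\<dots> = ennreal (unit_ball_vol 3)"
      using emeasure_ball[of 1 "0 :: real^3"] by simp
    also have "unit_ball_vol 3 = 4 / 3 * pi"
      by (rule unit_ball_vol_3)
    finally show ?thesis .
  qed
  have "emeasure sphere_measure (sphere 0 1) = 3 * emeasure (distr ?M ?N sgn) (sphere 0 1)"
    by (simp add: sphere_measure_def)
  also have "emeasure (distr ?M ?N sgn) (sphere 0 1) =
      emeasure ?M (sgn -` sphere 0 1 \<inter> space ?M)"
    by (rule emeasure_distr[OF sgn_meas]) (metis sets.top space_restrict_space space_borel Int_UNIV_right)
  also have "sgn -` sphere 0 1 \<inter> space ?M = ball 0 1 - {0}"
    by (auto simp: space_restrict_space norm_sgn)
  also have "emeasure ?M (ball 0 1 - {0}) = emeasure lborel (ball 0 1 - {0 :: real^3})"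
    by (rule emeasure_restrict_space) auto
  also have "3 * \<dots> = ennreal (3 * (4 / 3 * pi))"
    unfolding vol by (subst ennreal_mult) auto
  finally show ?thesis by simp
qed

section \<open>The relativistic Boltzmann collision operator\<close>

definition energy :: "real \<Rightarrow> real^3 \<Rightarrow> real" where
  "energy c v = sqrt (c\<^sup>2 + (norm v)\<^sup>2)"

definition rel_mom :: "real \<Rightarrow> real^3 \<Rightarrow> real^3 \<Rightarrow> real" where
  "rel_mom c v u = sqrt (2 * (energy c v * energy c u - v \<bullet> u - c\<^sup>2))"

definition mandelstam_s :: "real \<Rightarrow> real^3 \<Rightarrow> real^3 \<Rightarrow> real" where
  "mandelstam_s c v u = 2 * (energy c v * energy c u - v \<bullet> u + c\<^sup>2)"

definition moller_vel :: "real \<Rightarrow> real^3 \<Rightarrow> real^3 \<Rightarrow> real" where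
  "moller_vel c v u =
     c * rel_mom c v u * sqrt (mandelstam_s c v u) / (4 * energy c v * energy c u)"

definition boosted_dir :: "real \<Rightarrow> real^3 \<Rightarrow> real^3 \<Rightarrow> real^3 \<Rightarrow> real^3" where
  "boosted_dir c v u \<omega> =
     \<omega> + (((v + u) \<bullet> \<omega>) /
            (sqrt (mandelstam_s c v u) * (energy c v + energy c u + sqrt (mandelstam_s c v u))))
          *\<^sub>R (v + u)"

definition post_v :: "real \<Rightarrow> real^3 \<Rightarrow> real^3 \<Rightarrow> real^3 \<Rightarrow> real^3" where
  "post_v c v u \<omega> = (1 / 2) *\<^sub>R (v + u) + (rel_mom c v u / 2) *\<^sub>R boosted_dir c v u \<omega>"

definition post_u :: "real \<Rightarrow> real^3 \<Rightarrow> real^3 \<Rightarrow> real^3 \<Rightarrow> real^3" where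
  "post_u c v u \<omega> = (1 / 2) *\<^sub>R (v + u) - (rel_mom c v u / 2) *\<^sub>R boosted_dir c v u \<omega>"

definition cos_scatter :: "real \<Rightarrow> real^3 \<Rightarrow> real^3 \<Rightarrow> real^3 \<Rightarrow> real" where
  "cos_scatter c v u \<omega> =
     (- (energy c v - energy c u) * (energy c (post_v c v u \<omega>) - energy c (post_u c v u \<omega>))
        + (v - u) \<bullet> (post_v c v u \<omega> - post_u c v u \<omega>)) / (rel_mom c v u)\<^sup>2"

definition cross_section :: "real \<Rightarrow> (real \<Rightarrow> real) \<Rightarrow> real \<Rightarrow> real \<Rightarrow> real" where
  "cross_section \<gamma> \<sigma>\<^sub>0 g \<theta> = \<bar>g\<bar> powr (\<gamma> - 1) * \<sigma>\<^sub>0 \<theta>"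

definition coll_kernel ::
  "real \<Rightarrow> real \<Rightarrow> (real \<Rightarrow> real) \<Rightarrow> real^3 \<Rightarrow> real^3 \<Rightarrow> real^3 \<Rightarrow> real" where
  "coll_kernel c \<gamma> \<sigma>\<^sub>0 v u \<omega> =
     moller_vel c v u * cross_section \<gamma> \<sigma>\<^sub>0 (rel_mom c v u) (arccos (cos_scatter c v u \<omega>))"

definition coll_op ::
  "real \<Rightarrow> real \<Rightarrow> (real \<Rightarrow> real) \<Rightarrow> (real^3 \<Rightarrow> real) \<Rightarrow> (real^3 \<Rightarrow> real) \<Rightarrow> real^3 \<Rightarrow> real"
  where
  "coll_op c \<gamma> \<sigma>\<^sub>0 h f v =
     (LINT u|lborel. LINT \<omega>|sphere_measure.
        coll_kernel c \<gamma> \<sigma>\<^sub>0 v u \<omega> * (h (post_u c v u \<omega>) * f (post_v c v u \<omega>) - h u * f v))"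

text \<open>
  For fixed \<open>v\<close>, bounded angular part and large \<open>u\<close> the collision kernel is
  \<open>O(|u| powr ((\<gamma> - 1) / 2))\<close>, and this power is integrable on $R^3$ against \<open>|u| powr (- k)\<close> exactly when \<open>k > (\<gamma> + 5) / 2\<close>. By conservation
  of energy one of the two post-collisional energies is at least half of the total, so the same
  rate makes the gain term converge.
\<close>

definition decays :: "real \<Rightarrow> (real^3 \<Rightarrow> real) \<Rightarrow> bool" where
  "decays \<gamma> f \<longleftrightarrow> (\<exists>k > (\<gamma> + 5) / 2. \<exists>C. \<forall>v. \<bar>f v\<bar> \<le> C * (1 + norm v) powr (- k))"

end

theory Submission
  imports Defs
begin

text \<open>
  The formula expresses the Lorentz invariance of the collision operator. Let \<open>B\<^sub>t\<close> be the boost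
  of rapidity \<open>t\<close> along the \<open>j\<close>-th axis, acting on momenta of mass \<open>c\<close> (\<open>boost_mom\<close>). It moves the
  \<open>j\<close>-th component with speed equal to the energy, so that
  \<open>d/dt f (B\<^sub>t v) = (v\<^sub>0 \<partial>\<^sub>j f) (B\<^sub>t v)\<close>: the operators \<open>v\<^sub>0 \<partial>\<^sub>j\<close> of the statement generate the
  boosts.

  The kernel cannot be differentiated in \<open>v\<close>, because the angular part of the cross section is only
  measurable. Instead the variables of integration are boosted together with
  \<open>v\<close>. In \<open>Q(h,f)(B\<^sub>t v)\<close> substitute \<open>u = B\<^sub>t w\<close>, whose Jacobian is the quotient of the energies of
  \<open>B\<^sub>t w\<close> and \<open>w\<close>, and rotate \<open>\<omega>\<close>. The rotation is needed since \<open>\<omega>\<close> is a direction in the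
  centre-of-momentum frame, and the standard frames attached to \<open>(v,w)\<close> and to \<open>(B\<^sub>t v, B\<^sub>t w)\<close>
  differ, after the boost, by a rotation (the Wigner rotation). With this rotation the boost carries
  the post-collisional momenta to post-collisional momenta, and the relative momentum \<open>g\<close>, the
  invariant \<open>s\<close> and the scattering angle are unchanged. Hence (\<open>coll_op_boost\<close>)
  \[ (B_t v)_0\, Q(h,f)(B_t v) = \int\!\!\int v_0\, B_c(v,w)\,
       \bigl(h(B_t w') f(B_t v') - h(B_t w) f(B_t v)\bigr)\, d\omega\, dw , \]
  where \<open>t\<close> occurs in the arguments of \<open>h\<close> and \<open>f\<close> only. Differentiation under the integral at
  \<open>t = 0\<close> gives \<open>v\<^sub>0 (Q(v\<^sub>0 \<partial>\<^sub>j h, f) + Q(h, v\<^sub>0 \<partial>\<^sub>j f))\<close>. Since \<open>v + \<tau> e\<^sub>j\<close> is a boost of \<open>v\<close> whose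
  rapidity has derivative \<open>1 / v\<^sub>0\<close> in \<open>\<tau>\<close> at \<open>0\<close>, the chain rule and the derivative \<open>v\<^sub>j / v\<^sub>0\<close> of
  the energy yield the claim.

  Dominated convergence rests on \<open>boosted_integrand_bound\<close>. As \<open>g\<^sup>2\<close> is at least a multiple of
  \<open>|v - w|\<^sup>2 / w\<^sub>0\<close>, and \<open>s\<close> at most a multiple of \<open>w\<^sub>0\<close>, the kernel is bounded by a multiple of
  \<open>|v - w| powr \<gamma> * w\<^sub>0 powr (- \<gamma>/2 - 1/2)\<close>. By conservation of energy one of the two outgoing
  energies is at least \<open>w\<^sub>0 / 2\<close>, so both products of distribution functions decay like
  \<open>w\<^sub>0 powr (- k)\<close>, and \<open>k > (\<gamma> + 5) / 2\<close> is what makes the resulting weight integrable at infinity.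
\<close>

section \<open>Integration over Euclidean space\<close>

text \<open>
  By the mean value theorem the majorant of the derivatives also dominates the difference quotients,
  so dominated convergence applies to them along every sequence that tends to \<open>a\<close>.
\<close>

lemma has_real_derivative_lebesgue_integral:
  fixes F F' :: "real \<Rightarrow> 'a \<Rightarrow> real"
  assumes r: "0 < r"
    and int: "\<And>t. \<bar>t - a\<bar> < r \<Longrightarrow> integrable M (F t)"
    and meas: "F' a \<in> borel_measurable M"
    and der: "\<And>t x. \<bar>t - a\<bar> < r \<Longrightarrow> x \<in> space M \<Longrightarrow>
                ((\<lambda>t. F t x) has_real_derivative F' t x) (at t)"
    and w: "integrable M w"
    and bnd: "\<And>t x. \<bar>t - a\<bar> < r \<Longrightarrow> x \<in> space M \<Longrightarrow> \<bar>F' t x\<bar> \<le> w x"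
  shows "((\<lambda>t. \<integral>x. F t x \<partial>M) has_real_derivative (\<integral>x. F' a x \<partial>M)) (at a)"
  unfolding has_field_derivative_iff tendsto_at_iff_sequentially comp_def
proof (intro allI impI)
  fix X :: "nat \<Rightarrow> real"
  assume Xne: "\<forall>i. X i \<in> UNIV - {a}" and X: "X \<longlonglongrightarrow> a"
  \<comment> \<open>The difference quotient, set to \<open>0\<close> for the finitely many \<open>n\<close> at which the bounds on the
    derivative do not reach \<open>X n\<close>.\<close>
  define s where "s n x = (if \<bar>X n - a\<bar> < r then (F (X n) x - F a x) / (X n - a) else 0)" for n x
  have near: "\<forall>\<^sub>F n in sequentially. \<bar>X n - a\<bar> < r"
    using tendstoD[OF X r] by (simp add: dist_real_def)
  have int_a: "integrable M (F a)"
    using int[of a] r by simp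
  have "(\<lambda>n. \<integral>x. s n x \<partial>M) \<longlonglongrightarrow> (\<integral>x. F' a x \<partial>M)"
  proof (rule integral_dominated_convergence[where w = w])
    show "F' a \<in> borel_measurable M" by (rule meas)
    show "integrable M w" by (rule w)
    show "s n \<in> borel_measurable M" for n
    proof (cases "\<bar>X n - a\<bar> < r")
      case True
      then show ?thesis
        using int[OF True] int_a by (auto simp: s_def[abs_def] intro!: borel_measurable_divide borel_measurable_diff)
    qed (simp add: s_def[abs_def])
    show "AE x in M. (\<lambda>n. s n x) \<longlonglongrightarrow> F' a x"
    proof (rule AE_I2)
      fix x assume x: "x \<in> space M"
      have "((\<lambda>t. F t x) has_real_derivative F' a x) (at a)"
        using der[of a x] r x by simp
      then have "((\<lambda>y. (F y x - F a x) / (y - a)) \<longlongrightarrow> F' a x) (at a)"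
        by (simp add: has_field_derivative_iff)
      then have "(\<lambda>n. (F (X n) x - F a x) / (X n - a)) \<longlonglongrightarrow> F' a x"
        using Xne X unfolding tendsto_at_iff_sequentially comp_def by blast
      then show "(\<lambda>n. s n x) \<longlonglongrightarrow> F' a x"
        by (rule Lim_transform_eventually) (use near in eventually_elim, simp add: s_def)
    qed
    show "AE x in M. norm (s n x) \<le> w x" for n
    proof (rule AE_I2)
      fix x assume x: "x \<in> space M"
      show "norm (s n x) \<le> w x"
      proof (cases "\<bar>X n - a\<bar> < r")
        case False
        have "0 \<le> \<bar>F' a x\<bar>" by simp
        also have "\<dots> \<le> w x" using bnd[of a x] r x by simp
        finally show ?thesis using False by (simp add: s_def)
      next
        case True
        have "norm (F (X n) x - F a x) \<le> w x * norm (X n - a)"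
        proof (rule field_differentiable_bound[where S = "{a - r <..< a + r}" and f' = "\<lambda>t. F' t x"])
          show "convex {a - r <..< a + r}" by simp
          show "((\<lambda>t. F t x) has_field_derivative F' t x) (at t within {a - r <..< a + r})"
            if "t \<in> {a - r <..< a + r}" for t
            using that x by (intro has_field_derivative_at_within[OF der]) (simp_all add: abs_less_iff)
          show "norm (F' t x) \<le> w x" if "t \<in> {a - r <..< a + r}" for t
            using that bnd[of t x] x by (simp add: abs_less_iff)
        qed (use True r in \<open>simp_all add: abs_less_iff\<close>)
        then show ?thesis
          using True Xne by (simp add: s_def field_simps)
      qed
    qed
  qed
  moreover have "\<forall>\<^sub>F n in sequentially.
      (\<integral>x. s n x \<partial>M) = ((\<integral>x. F (X n) x \<partial>M) - (\<integral>x. F a x \<partial>M)) / (X n - a)"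
    using near
  proof eventually_elim
    case (elim n)
    then show ?case
      using int[OF elim] int_a by (simp add: s_def[abs_def])
  qed
  ultimately show "(\<lambda>n. ((\<integral>x. F (X n) x \<partial>M) - (\<integral>x. F a x \<partial>M)) / (X n - a))
      \<longlonglongrightarrow> (\<integral>x. F' a x \<partial>M)"
    by (rule Lim_transform_eventually)
qed

lemma orthogonal_measurable_borel:
  fixes R :: "real^'n \<Rightarrow> real^'n"
  assumes "orthogonal_transformation R"
  shows "R \<in> borel \<rightarrow>\<^sub>M borel"
  using orthogonal_transformation_linear[OF assms]
  by (intro borel_measurable_continuous_onI linear_continuous_on) (simp add: linear_linear)

lemma lborel_distr_orthogonal:
  fixes R :: "real^'n::{finite,wellorder} \<Rightarrow> real^'n::_"
  assumes R: "orthogonal_transformation R"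
  shows "distr lborel borel R = lborel"
proof (rule lborel_eqI[symmetric])
  have [measurable]: "R \<in> borel \<rightarrow>\<^sub>M borel"
    by (rule orthogonal_measurable_borel[OF R])
  obtain S where S: "orthogonal_transformation S" "\<And>x. S (R x) = x" "\<And>x. R (S x) = x"
    using orthogonal_transformation_inv[OF R] orthogonal_transformation_bij[OF R]
    by (metis bij_inv_eq_iff)
  fix l u :: "real^'n::{finite,wellorder}"
  assume lu: "\<And>b. b \<in> Basis \<Longrightarrow> l \<bullet> b \<le> u \<bullet> b"
  have "R -` box l u = S ` box l u"
    using S by (auto simp: image_iff) metis
  moreover have "R -` box l u \<in> sets borel"
    using measurable_sets_borel[of R borel "box l u"] by simp
  ultimately have "emeasure (distr lborel borel R) (box l u) = emeasure lebesgue (S ` box l u)"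
    by (simp add: emeasure_distr)
  also have "\<dots> = emeasure lebesgue (box l u)"
    using measure_orthogonal_image[OF S(1), of "box l u"] measurable_orthogonal_image[OF S(1), of "box l u"]
    by (simp add: emeasure_eq_measure2)
  also have "\<dots> = (\<Prod>b\<in>Basis. (u - l) \<bullet> b)"
    using lu by simp
  finally show "emeasure (distr lborel borel R) (box l u) = (\<Prod>b\<in>Basis. (u - l) \<bullet> b)" .
qed simp

text \<open>
  The change-of-variables theorem for vector-valued absolutely integrable functions, applied to
  functions with values in \<open>real^1\<close>. Borel measurability allows the passage from the completed to the
  Borel measure.
\<close>

lemma lborel_change_of_variables:
  fixes \<phi> :: "real^'n::{finite,wellorder} \<Rightarrow> real^'n::_" and F :: "real^'n::_ \<Rightarrow> real"
  assumes der: "\<And>x. (\<phi> has_derivative \<phi>' x) (at x)" and bij: "bij \<phi>"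
    and F: "F \<in> borel_measurable borel"
    and int: "integrable lborel (\<lambda>x. \<bar>det (matrix (\<phi>' x))\<bar> * F (\<phi> x))"
  shows "(LINT y|lborel. F y) = (LINT x|lborel. \<bar>det (matrix (\<phi>' x))\<bar> * F (\<phi> x))"
proof -
  let ?D = "\<lambda>x. \<bar>det (matrix (\<phi>' x))\<bar> * F (\<phi> x)"
  have vec_scale: "\<bar>det (matrix (\<phi>' x))\<bar> *\<^sub>R (vec (F (\<phi> x)) :: real^1) = vec (?D x)" for x
    by (simp add: vec_eq_iff)
  have iff: "(\<lambda>x. vec (?D x) :: real^1) absolutely_integrable_on UNIV \<and>
        integral UNIV (\<lambda>x. vec (?D x) :: real^1) = b
      \<longleftrightarrow> (\<lambda>y. vec (F y) :: real^1) absolutely_integrable_on UNIV \<and>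
        integral UNIV (\<lambda>y. vec (F y) :: real^1) = b" for b
    using has_absolute_integral_change_of_variables
      [of UNIV \<phi> \<phi>' "\<lambda>y. vec (F y) :: real^1" b] der bij
    by (simp add: vec_scale bij_def)
  have intD: "?D absolutely_integrable_on UNIV"
    using integrable_completion[of ?D lborel] int by (simp add: set_integrable_def borel_measurable_integrable)
  then have D1: "(\<lambda>x. vec (?D x) :: real^1) absolutely_integrable_on UNIV"
    by (simp add: absolutely_integrable_on_1_iff)
  then have F1: "(\<lambda>y. vec (F y) :: real^1) absolutely_integrable_on UNIV"
    and eq: "integral UNIV (\<lambda>y. vec (F y) :: real^1) = integral UNIV (\<lambda>x. vec (?D x) :: real^1)"
    using iff by blast+
  have intF: "F absolutely_integrable_on UNIV"
    using F1 by (simp add: absolutely_integrable_on_1_iff)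
  have "integrable lborel F"
    using integrable_completion[of F lborel] intF F by (simp add: set_integrable_def)
  then have "(LINT y|lborel. F y) = integral UNIV F"
    by (simp add: integral_lborel)
  also have "\<dots> = integral UNIV ?D"
    using arg_cong[OF eq, of "\<lambda>z. z $ 1"] F1 D1
    by (simp add: integral_on_1_eq absolutely_integrable_on_def)
  also have "\<dots> = (LINT x|lborel. ?D x)"
    using int by (simp add: integral_lborel)
  finally show ?thesis .
qed

section \<open>Rotation invariance of the surface measure\<close>

lemma sgn_measurable_sphere:
  "sgn \<in> restrict_space lborel (ball 0 1 - {0 :: real^3}) \<rightarrow>\<^sub>M restrict_space borel (sphere 0 1)"
proof (rule measurable_restrict_space2)
  show "sgn \<in> space (restrict_space lborel (ball 0 1 - {0})) \<rightarrow> sphere (0 :: real^3) 1"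
    by (auto simp: space_restrict_space norm_sgn)
  have "(sgn :: real^3 \<Rightarrow> real^3) \<in> borel \<rightarrow>\<^sub>M borel"
    unfolding sgn_div_norm[abs_def] by measurable
  then show "sgn \<in> borel_measurable (restrict_space lborel (ball 0 1 - {0 :: real^3}))"
    by (intro measurable_restrict_space1) simp
qed

lemma sets_sphere_measure [measurable_cong]:
  "sets sphere_measure = sets (restrict_space borel (sphere 0 1))"
  by (simp add: sphere_measure_def)

lemma emeasure_sphere_measure:
  assumes "A \<in> sets sphere_measure"
  shows "emeasure sphere_measure A = 3 * emeasure lborel {x \<in> ball 0 1 - {0}. sgn x \<in> A}"
proof -
  let ?M = "restrict_space lborel (ball 0 1 - {0 :: real^3})"
  have A: "A \<in> sets (restrict_space borel (sphere 0 1))"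
    using assms by (simp add: sets_sphere_measure)
  have "emeasure sphere_measure A = 3 * emeasure ?M (sgn -` A \<inter> space ?M)"
    by (simp add: sphere_measure_def emeasure_distr[OF sgn_measurable_sphere A])
  also have "emeasure ?M (sgn -` A \<inter> space ?M) = emeasure lborel (sgn -` A \<inter> space ?M)"
    by (rule emeasure_restrict_space) (auto simp: space_restrict_space)
  also have "sgn -` A \<inter> space ?M = {x \<in> ball 0 1 - {0}. sgn x \<in> A}"
    by (auto simp: space_restrict_space)
  finally show ?thesis .
qed

lemma finite_sphere_measure: "finite_measure sphere_measure"
  by (rule finite_measureI) (simp add: space_sphere_measure emeasure_sphere_measure_space)

lemma orthogonal_measurable_sphere:
  assumes R: "orthogonal_transformation R"
  shows "R \<in> sphere_measure \<rightarrow>\<^sub>M sphere_measure"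
  unfolding measurable_cong_sets[OF sets_sphere_measure sets_sphere_measure]
  by (intro measurable_restrict_space2 measurable_restrict_space1 orthogonal_measurable_borel[OF R])
     (auto simp: space_restrict_space orthogonal_transformation_norm[OF R])

text \<open>
  The surface measure of a set is, up to a factor, the volume of the cone over it; an orthogonal map
  commutes with the radial projection and preserves volume.
\<close>

lemma sphere_measure_distr_orthogonal:
  assumes R: "orthogonal_transformation R"
  shows "distr sphere_measure sphere_measure R = sphere_measure"
proof (rule measure_eqI)
  have lin: "linear R" by (rule orthogonal_transformation_linear[OF R])
  note R_borel = orthogonal_measurable_borel[OF R] and R_sphere = orthogonal_measurable_sphere[OF R]
  have norm_R: "norm (R x) = norm x" for x
    by (rule orthogonal_transformation_norm[OF R])
  fix A assume "A \<in> sets (distr sphere_measure sphere_measure R)"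
  then have A: "A \<in> sets sphere_measure" by simp
  let ?cone = "\<lambda>A. {x \<in> ball 0 1 - {0 :: real^3}. sgn x \<in> A}"
  have pre: "R -` A \<inter> space sphere_measure \<in> sets sphere_measure"
    by (rule measurable_sets[OF R_sphere A])
  have cone: "?cone A \<in> sets borel"
  proof -
    have "sgn -` A \<inter> space (restrict_space lborel (ball 0 1 - {0 :: real^3}))
        \<in> sets (restrict_space lborel (ball 0 1 - {0 :: real^3}))"
      using A by (intro measurable_sets[OF sgn_measurable_sphere]) (simp add: sets_sphere_measure)
    moreover have "sgn -` A \<inter> space (restrict_space lborel (ball 0 1 - {0 :: real^3})) = ?cone A"
      by (auto simp: space_restrict_space)
    ultimately show ?thesis
      by (subst (asm) sets_restrict_space_iff) auto
  qed
  have sgn_R: "sgn (R x) = R (sgn x)" for x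
    by (simp add: sgn_div_norm norm_R linear_cmul[OF lin])
  have "?cone (R -` A \<inter> space sphere_measure) = R -` ?cone A"
  proof -
    have "R x = 0 \<longleftrightarrow> x = 0" for x
      by (metis norm_R norm_eq_zero)
    then show ?thesis
      by (auto simp: space_sphere_measure norm_R sgn_R norm_sgn)
  qed
  then have "emeasure (distr sphere_measure sphere_measure R) A =
      3 * emeasure lborel (R -` ?cone A)"
    by (simp add: emeasure_distr[OF R_sphere A] emeasure_sphere_measure[OF pre])
  also have "emeasure lborel (R -` ?cone A) = emeasure (distr lborel borel R) (?cone A)"
    using R_borel cone by (simp add: emeasure_distr)
  also have "\<dots> = emeasure lborel (?cone A)"
    by (simp add: lborel_distr_orthogonal[OF R])
  finally show "emeasure (distr sphere_measure sphere_measure R) A = emeasure sphere_measure A"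
    by (simp add: emeasure_sphere_measure[OF A])
qed simp

lemma integral_sphere_measure_orthogonal:
  fixes G :: "real^3 \<Rightarrow> real"
  assumes R: "orthogonal_transformation R" and G: "G \<in> borel_measurable sphere_measure"
  shows "(LINT \<omega>|sphere_measure. G (R \<omega>)) = (LINT \<omega>|sphere_measure. G \<omega>)"
  using integral_distr[OF orthogonal_measurable_sphere[OF R] G]
  by (simp add: sphere_measure_distr_orthogonal[OF R])

section \<open>Integrability of the singular weight\<close>

lemma energy_sq: "(energy c v)\<^sup>2 = c\<^sup>2 + v \<bullet> v"
  by (simp add: energy_def power2_norm_eq_inner)

lemma norm_le_energy: "norm v \<le> energy c v"
  unfolding energy_def by (rule real_le_rsqrt) simp

lemma norm_less_energy: "c \<ge> 1 \<Longrightarrow> norm v < energy c v"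
  unfolding energy_def by (rule real_less_rsqrt) simp

lemma c_le_energy: "c \<le> energy c v"
  unfolding energy_def by (rule real_le_rsqrt) simp

lemma energy_pos: "c \<ge> 1 \<Longrightarrow> 0 < energy c v"
  using c_le_energy[of c v] by linarith

lemma energy_le: "c \<ge> 1 \<Longrightarrow> energy c v \<le> c * (1 + norm v)"
proof -
  assume c: "c \<ge> 1"
  have "energy c v \<le> c + norm v"
    unfolding energy_def by (rule real_le_lsqrt) (use c in \<open>auto simp: power2_sum\<close>)
  also have "\<dots> \<le> c * (1 + norm v)"
    using mult_right_mono[OF c norm_ge_zero[of v]] by (simp add: algebra_simps)
  finally show ?thesis .
qed

lemma measurable_energy [measurable]: "energy c \<in> borel_measurable borel"
  unfolding energy_def[abs_def] by measurable

text \<open>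
  A substitute for polar coordinates: a function with power-like radial behaviour is compared with a
  series of multiples of indicators of balls whose radii form a geometric progression.
\<close>

lemma integrable_ball_majorant:
  fixes g :: "'a::euclidean_space \<Rightarrow> real"
  assumes g: "g \<in> borel_measurable borel"
    and r: "\<And>n. 0 \<le> r n" and a: "\<And>n. 0 \<le> a n"
    and sum: "summable (\<lambda>n. a n * r n ^ DIM('a))"
    and bnd: "\<And>x. \<exists>n. \<bar>g x\<bar> \<le> a n * indicator (ball 0 (r n)) x"
  shows "integrable lborel g"
proof (rule integrableI_bounded)
  show "g \<in> borel_measurable lborel" using g by simp
  let ?u = "unit_ball_vol (real DIM('a))"
  have "(\<integral>\<^sup>+ x. ennreal (norm (g x)) \<partial>lborel)
      \<le> (\<integral>\<^sup>+ (x::'a). (\<Sum>n. ennreal (a n) * indicator (ball 0 (r n)) x) \<partial>lborel)"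
  proof (rule nn_integral_mono)
    fix x :: 'a
    obtain n where "\<bar>g x\<bar> \<le> a n * indicator (ball 0 (r n)) x" using bnd by blast
    then have "ennreal (norm (g x)) \<le> ennreal (a n * indicator (ball 0 (r n)) x)"
      by (simp add: ennreal_leI)
    also have "\<dots> = ennreal (a n) * indicator (ball 0 (r n)) x"
      by (simp add: indicator_def)
    also have "\<dots> = (\<Sum>k\<in>{n}. ennreal (a k) * indicator (ball 0 (r k)) x)"
      by (simp only: sum.insert[OF finite.emptyI] sum.empty add_0_right empty_iff not_False_eq_True)
    also have "\<dots> \<le> (\<Sum>k. ennreal (a k) * indicator (ball 0 (r k)) x)"
      by (rule sum_le_suminf) auto
    finally show "ennreal (norm (g x)) \<le> (\<Sum>k. ennreal (a k) * indicator (ball 0 (r k)) x)" .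
  qed
  also have "\<dots> = (\<Sum>n. ennreal (a n) * emeasure lborel (ball (0::'a) (r n)))"
    by (subst nn_integral_suminf) (auto simp: nn_integral_cmult_indicator intro!: borel_measurable_times_ennreal borel_measurable_indicator)
  also have "\<dots> = (\<Sum>n. ennreal (?u * (a n * r n ^ DIM('a))))"
    by (simp add: emeasure_ball r a ennreal_mult[symmetric] mult_ac)
  also have "\<dots> = ennreal (\<Sum>n. ?u * (a n * r n ^ DIM('a)))"
    by (intro suminf_ennreal2 summable_mult sum) (auto simp: r a)
  also have "\<dots> < \<infinity>" by simp
  finally show "(\<integral>\<^sup>+ x. ennreal (norm (g x)) \<partial>lborel) < \<infinity>" .
qed

lemma integrable_norm_powr_ball:
  assumes "-3 < \<gamma>" "\<gamma> \<le> 0"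
  shows "integrable lborel (\<lambda>x::real^3. indicator (ball 0 1) x * norm x powr \<gamma>)"
proof (rule integrable_ball_majorant[where a = "\<lambda>n. ((1/2) ^ (n + 1)) powr \<gamma>" and r = "\<lambda>n. (1/2) ^ n"])
  show "(\<lambda>x::real^3. indicator (ball 0 1) x * norm x powr \<gamma>) \<in> borel_measurable borel"
    by (intro borel_measurable_times borel_measurable_indicator powr_real_measurable) auto
  have "((1/2::real) ^ (n + 1)) powr \<gamma> * ((1/2) ^ n) ^ DIM(real^3) =
      (1/2) powr \<gamma> * ((1/2) powr (\<gamma> + 3)) ^ n" for n
  proof -
    have "((1/2::real) ^ (n + 1)) powr \<gamma> = (1/2) powr (\<gamma> * (n + 1))"
      by (simp add: powr_realpow[symmetric] powr_powr mult_ac del: power_Suc)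
    moreover have "((1/2::real) ^ n) ^ DIM(real^3) = (1/2) powr (3 * n)"
      by (simp add: powr_realpow[symmetric] powr_powr mult_ac flip: power_mult)
    moreover have "((1/2::real) powr (\<gamma> + 3)) ^ n = (1/2) powr ((\<gamma> + 3) * n)"
      by (simp add: powr_realpow[symmetric] powr_powr)
    ultimately show ?thesis
      by (simp add: powr_add[symmetric] algebra_simps)
  qed
  moreover have "(1/2::real) powr (\<gamma> + 3) < 1"
    using assms powr_less_mono[of 0 "\<gamma> + 3" 2] by (simp add: powr_divide)
  ultimately show "summable (\<lambda>n. ((1/2::real) ^ (n + 1)) powr \<gamma> * ((1/2) ^ n) ^ DIM(real^3))"
    by (simp add: summable_mult summable_geometric)
  fix x :: "real^3"
  show "\<exists>n. \<bar>indicator (ball 0 1) x * norm x powr \<gamma>\<bar>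
      \<le> ((1/2) ^ (n + 1)) powr \<gamma> * indicator (ball 0 ((1/2) ^ n)) x"
  proof (cases "x \<noteq> 0 \<and> norm x < 1")
    case True
    \<comment> \<open>The least such \<open>n\<close> is the dyadic shell that contains \<open>x\<close>; the shells shrink towards the
      singularity.\<close>
    define P where "P n \<longleftrightarrow> (1/2::real) ^ (n + 1) \<le> norm x" for n :: nat
    obtain m where "(1/2::real) ^ m < norm x"
      using real_arch_pow_inv[of "norm x" "1/2"] True by auto
    moreover have "(1/2::real) ^ (m + 1) \<le> (1/2) ^ m"
      by simp
    ultimately have "P m"
      unfolding P_def by linarith
    define n where "n = (LEAST n. P n)"
    have Pn: "P n" unfolding n_def by (rule LeastI) fact
    have "norm x < (1/2) ^ n"
    proof (cases n)
      case 0
      then show ?thesis using True by simp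
    next
      case (Suc k)
      then have "\<not> P k" using not_less_Least[of k P] by (simp add: n_def)
      then show ?thesis using Suc by (simp add: P_def)
    qed
    moreover have "norm x powr \<gamma> \<le> ((1/2) ^ (n + 1)) powr \<gamma>"
      using Pn assms by (intro powr_mono2') (auto simp: P_def)
    ultimately show ?thesis
      using True by (intro exI[of _ n]) simp
  qed (auto simp: indicator_def intro!: exI[of _ 0])
qed auto

lemma integrable_one_plus_norm_powr:
  assumes "3 < p"
  shows "integrable lborel (\<lambda>x::real^3. (1 + norm x) powr (- p))"
proof (rule integrable_ball_majorant[where a = "\<lambda>n. (2 ^ n) powr (- p)" and r = "\<lambda>n. 2 ^ (n + 1)"])
  show "(\<lambda>x::real^3. (1 + norm x) powr (- p)) \<in> borel_measurable borel"
    by measurable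
  have "(2 ^ n) powr (- p) * (2 ^ (n + 1)) ^ DIM(real^3) = 8 * ((2::real) powr (3 - p)) ^ n" for n
  proof -
    have "((2::real) ^ n) powr (- p) = 2 powr (- p * n)"
      by (simp add: powr_realpow[symmetric] powr_powr mult_ac)
    moreover have "((2::real) ^ (n + 1)) ^ DIM(real^3) = 8 * 2 powr (3 * n)"
    proof -
      have "((2::real) ^ (n + 1)) ^ 3 = 8 * 2 ^ (n * 3)"
        by (simp add: power_mult_distrib power_mult)
      also have "(2::real) ^ (n * 3) = 2 powr (3 * n)"
        using powr_realpow[of 2 "n * 3"] by (simp add: mult.commute)
      finally show ?thesis by simp
    qed
    moreover have "((2::real) powr (3 - p)) ^ n = 2 powr ((3 - p) * n)"
      by (simp add: powr_realpow[symmetric] powr_powr)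
    ultimately show ?thesis
      by (simp add: powr_add[symmetric] algebra_simps)
  qed
  moreover have "(2::real) powr (3 - p) < 1"
    using assms powr_less_mono[of "3 - p" 0 2] by simp
  ultimately show "summable (\<lambda>n. (2 ^ n) powr (- p) * ((2::real) ^ (n + 1)) ^ DIM(real^3))"
    by (simp only: summable_mult summable_geometric real_norm_def abs_of_nonneg powr_ge_zero)
  fix x :: "real^3"
  \<comment> \<open>Again the least such \<open>n\<close> is the dyadic shell of \<open>x\<close>; these shells grow towards infinity.\<close>
  define P where "P n \<longleftrightarrow> 1 + norm x < (2::real) ^ (n + 1)" for n :: nat
  obtain m where "1 + norm x < (2::real) ^ m"
    using real_arch_pow[of 2 "1 + norm x"] by auto
  moreover have "(2::real) ^ m \<le> 2 ^ (m + 1)" by simp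
  ultimately have "P m" unfolding P_def by linarith
  define n where "n = (LEAST n. P n)"
  have Pn: "P n" unfolding n_def by (rule LeastI) fact
  have "2 ^ n \<le> 1 + norm x"
  proof (cases n)
    case (Suc k)
    then have "\<not> P k" using not_less_Least[of k P] by (simp add: n_def)
    then show ?thesis using Suc by (simp add: P_def)
  qed simp
  then have "(1 + norm x) powr (- p) \<le> (2 ^ n) powr (- p)"
    using assms by (intro powr_mono2') auto
  moreover have "norm x < 2 ^ (n + 1)" using Pn by (simp add: P_def)
  ultimately show "\<exists>n. \<bar>(1 + norm x) powr (- p)\<bar>
      \<le> (2 ^ n) powr (- p) * indicator (ball 0 (2 ^ (n + 1))) x"
    by (intro exI[of _ n]) simp
qed auto

text \<open>
  Near \<open>v\<close> the energy factor is at most \<open>1\<close> and \<open>\<gamma> > -3\<close> is integrable in dimension three. Away from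
  \<open>v\<close> both factors are comparable to powers of \<open>1 + |w|\<close>, with total exponent \<open>\<gamma> - p < -3\<close>.
\<close>

lemma integrable_singular_weight:
  assumes c: "c \<ge> 1" and \<gamma>: "-3 < \<gamma>" "\<gamma> \<le> 0" and p: "\<gamma> + 3 < p"
  shows "integrable lborel (\<lambda>w. norm (v - w) powr \<gamma> * energy c w powr (- p))"
proof (rule Bochner_Integration.integrable_bound)
  let ?K = "(2 + norm v) powr (- \<gamma>) * 2 powr p"
  let ?G = "\<lambda>w. indicator (ball 0 1) (- v + w) * norm (- v + w) powr \<gamma>
      + ?K * (1 + norm w) powr (- (p - \<gamma>))"
  have "integrable (distr lborel borel ((+) (- v)))
      (\<lambda>x::real^3. indicator (ball 0 1) x * norm x powr \<gamma>)"
    using integrable_norm_powr_ball[OF \<gamma>] by (simp add: lborel_distr_plus)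
  then have "integrable lborel (\<lambda>w. indicator (ball 0 1) (- v + w) * norm (- v + w) powr \<gamma>)"
    by (subst (asm) integrable_distr_eq) (auto intro!: borel_measurable_times borel_measurable_indicator powr_real_measurable)
  moreover have "integrable lborel (\<lambda>w::real^3. (1 + norm w) powr (- (p - \<gamma>)))"
    using p by (intro integrable_one_plus_norm_powr) simp
  ultimately show "integrable lborel ?G"
    by (intro Bochner_Integration.integrable_add integrable_mult_right)
  show "(\<lambda>w. norm (v - w) powr \<gamma> * energy c w powr (- p)) \<in> borel_measurable lborel"
    by measurable
  show "AE w in lborel. norm (norm (v - w) powr \<gamma> * energy c w powr (- p)) \<le> norm (?G w)"
  proof (rule AE_I2)
    fix w
    have e1: "1 \<le> energy c w" using c_le_energy[of c w] c by linarith
    have d: "norm (- v + w) = norm (v - w)" by (simp add: norm_minus_commute)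
    have "norm (v - w) powr \<gamma> * energy c w powr (- p) \<le> ?G w"
    proof (cases "norm (v - w) < 1")
      case True
      have "energy c w powr (- p) \<le> 1"
        using e1 p \<gamma> powr_mono[of "- p" 0 "energy c w"] by simp
      then have "norm (v - w) powr \<gamma> * energy c w powr (- p) \<le> norm (v - w) powr \<gamma> * 1"
        by (rule mult_left_mono) simp
      also have "\<dots> = indicator (ball 0 1) (- v + w) * norm (- v + w) powr \<gamma>"
        using True d by simp
      finally show ?thesis by (simp add: add_increasing2)
    next
      case False
      have "norm w \<le> norm v + norm (v - w)"
        using norm_triangle_sub[of w v] by (simp add: norm_minus_commute)
      moreover have "norm v + 1 \<le> (norm v + 1) * norm (v - w)"
        using False mult_left_mono[of 1 "norm (v - w)" "norm v + 1"] by simp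
      ultimately have "1 + norm w \<le> (2 + norm v) * norm (v - w)"
        by (simp add: algebra_simps)
      then have "((2 + norm v) * norm (v - w)) powr \<gamma> \<le> (1 + norm w) powr \<gamma>"
        using \<gamma> by (intro powr_mono2') (auto simp: add_pos_nonneg)
      then have "(2 + norm v) powr \<gamma> * norm (v - w) powr \<gamma> \<le> (1 + norm w) powr \<gamma>"
        by (simp add: powr_mult)
      then have "(2 + norm v) powr (- \<gamma>) * ((2 + norm v) powr \<gamma> * norm (v - w) powr \<gamma>)
          \<le> (2 + norm v) powr (- \<gamma>) * (1 + norm w) powr \<gamma>"
        by (rule mult_left_mono) simp
      moreover have "(2 + norm v) powr (- \<gamma>) * (2 + norm v) powr \<gamma> = 1"
        using powr_add[of "2 + norm v" "- \<gamma>" \<gamma>] norm_ge_zero[of v] by simp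
      ultimately have A: "norm (v - w) powr \<gamma> \<le> (2 + norm v) powr (- \<gamma>) * (1 + norm w) powr \<gamma>"
        by (simp add: mult.assoc[symmetric])
      have "(1 + norm w) / 2 \<le> energy c w"
        using norm_le_energy[of w c] e1 by simp
      then have "energy c w powr (- p) \<le> ((1 + norm w) / 2) powr (- p)"
        using p \<gamma> by (intro powr_mono2') (auto simp: add_pos_nonneg)
      also have "\<dots> = 2 powr p * (1 + norm w) powr (- p)"
        by (simp add: powr_divide powr_minus_divide)
      finally have B: "energy c w powr (- p) \<le> 2 powr p * (1 + norm w) powr (- p)" .
      have "norm (v - w) powr \<gamma> * energy c w powr (- p)
          \<le> ((2 + norm v) powr (- \<gamma>) * (1 + norm w) powr \<gamma>) * (2 powr p * (1 + norm w) powr (- p))"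
        by (intro mult_mono A B) auto
      also have "\<dots> = ?K * ((1 + norm w) powr \<gamma> * (1 + norm w) powr (- p))"
        by (simp only: mult_ac)
      also have "(1 + norm w) powr \<gamma> * (1 + norm w) powr (- p) = (1 + norm w) powr (- (p - \<gamma>))"
        by (simp add: powr_add[symmetric])
      finally show ?thesis by (simp add: add_increasing)
    qed
    then show "norm (norm (v - w) powr \<gamma> * energy c w powr (- p)) \<le> norm (?G w)"
      by (simp add: abs_mult)
  qed
qed

section \<open>Four-momenta and the centre-of-momentum frame\<close>

type_synonym vec4 = "real \<times> (real^3)"

definition mink :: "vec4 \<Rightarrow> vec4 \<Rightarrow> real" where
  "mink X Y = fst X * fst Y - snd X \<bullet> snd Y"

lemma mink_commute: "mink X Y = mink Y X"
  by (simp add: mink_def inner_commute mult.commute)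

lemma mink_add_left: "mink (X + Y) Z = mink X Z + mink Y Z"
  and mink_diff_left: "mink (X - Y) Z = mink X Z - mink Y Z"
  and mink_scaleR_left: "mink (a *\<^sub>R X) Z = a * mink X Z"
  by (simp_all add: mink_def inner_simps algebra_simps)

lemma mink_add_right: "mink Z (X + Y) = mink Z X + mink Z Y"
  and mink_diff_right: "mink Z (X - Y) = mink Z X - mink Z Y"
  and mink_scaleR_right: "mink Z (a *\<^sub>R X) = a * mink Z X"
  by (simp_all add: mink_def inner_simps algebra_simps)

lemmas mink_simps = mink_add_left mink_diff_left mink_scaleR_left
  mink_add_right mink_diff_right mink_scaleR_right

definition mom4 :: "real \<Rightarrow> real^3 \<Rightarrow> vec4" where
  "mom4 c v = (energy c v, v)"

lemma mom4_simps [simp]: "fst (mom4 c v) = energy c v" "snd (mom4 c v) = v"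
  by (simp_all add: mom4_def)

lemma mink_mom4_self: "mink (mom4 c v) (mom4 c v) = c\<^sup>2"
  using energy_sq[of c v] by (simp add: mink_def power2_eq_square)

text \<open>
  A vector on the upper sheet of the mass shell is determined by its spatial part. This is how
  identities between energies are obtained below from Minkowski products.
\<close>

lemma eq_mom4I:
  assumes "0 \<le> fst X" "mink X X = c\<^sup>2"
  shows "X = mom4 c (snd X)"
proof -
  have "(fst X)\<^sup>2 = c\<^sup>2 + (norm (snd X))\<^sup>2"
    using assms(2) by (simp add: mink_def dot_square_norm) (simp add: power2_eq_square)
  then have "fst X = energy c (snd X)"
    using assms(1) unfolding energy_def by (metis real_sqrt_abs abs_of_nonneg)
  then show ?thesis by (simp add: mom4_def prod_eq_iff)
qed

lemma mink_mom4_ge: "c\<^sup>2 \<le> mink (mom4 c v) (mom4 c u)"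
proof -
  have cs: "v \<bullet> u \<le> norm v * norm u" by (rule norm_cauchy_schwarz)
  have "(c\<^sup>2 + norm v * norm u)\<^sup>2 \<le> (energy c v * energy c u)\<^sup>2"
  proof -
    \<comment> \<open>Cauchy--Schwarz in the plane for \<open>(c, |v|)\<close> and \<open>(c, |u|)\<close>.\<close>
    have "(energy c v * energy c u)\<^sup>2 - (c\<^sup>2 + norm v * norm u)\<^sup>2 = (c * (norm v - norm u))\<^sup>2"
      by (simp add: energy_def power_mult_distrib) (simp add: algebra_simps power2_eq_square)
    moreover have "0 \<le> (c * (norm v - norm u))\<^sup>2" by simp
    ultimately show ?thesis by linarith
  qed
  then have "c\<^sup>2 + norm v * norm u \<le> energy c v * energy c u"
    by (rule power2_le_imp_le) (simp add: energy_def)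
  with cs show ?thesis by (simp add: mink_def)
qed

lemma rel_mom_eq: "rel_mom c v u = sqrt (2 * (mink (mom4 c v) (mom4 c u) - c\<^sup>2))"
  by (simp add: rel_mom_def mink_def)

lemma rel_mom_sq: "(rel_mom c v u)\<^sup>2 = 2 * (mink (mom4 c v) (mom4 c u) - c\<^sup>2)"
  using mink_mom4_ge[of c v u] by (simp add: rel_mom_def mink_def)

lemma rel_mom_nonneg: "0 \<le> rel_mom c v u"
  using mink_mom4_ge[of c v u] by (simp add: rel_mom_def mink_def)

lemma mandelstam_s_eq: "mandelstam_s c v u = mink (mom4 c v + mom4 c u) (mom4 c v + mom4 c u)"
  by (simp add: mink_simps mink_mom4_self)
     (simp add: mandelstam_s_def mink_def inner_commute algebra_simps)

lemma mandelstam_s_rel_mom: "mandelstam_s c v u = (rel_mom c v u)\<^sup>2 + 4 * c\<^sup>2"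
  by (simp add: rel_mom_sq) (simp add: mandelstam_s_def mink_def)

lemma mandelstam_s_pos: "c \<ge> 1 \<Longrightarrow> 0 < mandelstam_s c v u"
  by (simp add: mandelstam_s_rel_mom add_nonneg_pos)

text \<open>
  For a timelike \<open>P\<close>, this is the pure boost from the rest frame of \<open>P\<close>, applied to the purely
  spatial vector \<open>n\<close>. It identifies three-dimensional space isometrically with the vectors
  Minkowski-orthogonal to \<open>P\<close>; its inverse there is \<open>unlift P\<close>. For the total momentum \<open>P\<close> of a pair,
  the spatial part of \<open>lift P \<omega>\<close> is the vector that multiplies \<open>g/2\<close> in the post-collisional momenta.
\<close>

definition lift :: "vec4 \<Rightarrow> real^3 \<Rightarrow> vec4" where
  "lift P n = ((snd P \<bullet> n) / sqrt (mink P P),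
     n + ((snd P \<bullet> n) / (sqrt (mink P P) * (fst P + sqrt (mink P P)))) *\<^sub>R snd P)"

definition unlift :: "vec4 \<Rightarrow> vec4 \<Rightarrow> real^3" where
  "unlift P X = snd X - (fst X / (fst P + sqrt (mink P P))) *\<^sub>R snd P"

lemma linear_lift: "linear (lift P)"
  by (rule linearI) (simp_all add: lift_def inner_simps algebra_simps add_divide_distrib)

lemma linear_unlift: "linear (unlift P)"
  by (rule linearI) (simp_all add: unlift_def algebra_simps add_divide_distrib)

context
  fixes P :: vec4
  assumes P: "0 < fst P" "0 < mink P P"
begin

lemma sqrt_mink_pos: "0 < sqrt (mink P P)" "0 < fst P + sqrt (mink P P)"
  using P by (simp_all add: add_pos_pos)

text \<open>
  The factor \<open>fst P + sqrt (mink P P)\<close> is the one in the denominators of \<open>lift\<close> and \<open>unlift\<close>.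
\<close>

lemma snd_sq: "snd P \<bullet> snd P = (fst P - sqrt (mink P P)) * (fst P + sqrt (mink P P))"
proof -
  have "(sqrt (mink P P))\<^sup>2 = fst P * fst P - snd P \<bullet> snd P"
    using P by (simp add: mink_def)
  then show ?thesis by (simp add: algebra_simps power2_eq_square)
qed

lemma mink_lift_lift: "mink (lift P m) (lift P n) = - (m \<bullet> n)"
proof -
  define q E p where "q = sqrt (mink P P)" and "E = fst P" and "p = snd P"
  define a b k l where "a = p \<bullet> m" and "b = p \<bullet> n" and "k = a / (q * (E + q))" and "l = b / (q * (E + q))"
  have pos: "q \<noteq> 0" "E + q \<noteq> 0" using sqrt_mink_pos by (simp_all add: q_def E_def)
  have pp: "p \<bullet> p = (E - q) * (E + q)" using snd_sq by (simp add: p_def q_def E_def)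
  have ab: "p \<bullet> m = a" "m \<bullet> p = a" "p \<bullet> n = b" "n \<bullet> p = b"
    by (simp_all add: a_def b_def inner_commute)
  have "lift P m = (a / q, m + k *\<^sub>R p)" "lift P n = (b / q, n + l *\<^sub>R p)"
    by (simp_all add: lift_def q_def E_def p_def a_def b_def k_def l_def)
  then have "mink (lift P m) (lift P n) = (a / q) * (b / q) - (m \<bullet> n + l * a + k * b
      + k * l * ((E - q) * (E + q)))"
    by (simp add: mink_def inner_add_left inner_add_right pp ab) (simp add: algebra_simps)
  also have "\<dots> = - (m \<bullet> n)"
    using pos unfolding k_def l_def by (simp add: divide_simps) algebra
  finally show ?thesis .
qed

lemma mink_total_lift: "mink P (lift P n) = 0"
proof -
  define q E p where "q = sqrt (mink P P)" and "E = fst P" and "p = snd P"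
  define a k where "a = p \<bullet> n" and "k = a / (q * (E + q))"
  have pos: "q \<noteq> 0" "E + q \<noteq> 0" using sqrt_mink_pos by (simp_all add: q_def E_def)
  have pp: "p \<bullet> p = (E - q) * (E + q)" using snd_sq by (simp add: p_def q_def E_def)
  have "lift P n = (a / q, n + k *\<^sub>R p)"
    by (simp add: lift_def q_def E_def p_def a_def k_def)
  then have "mink P (lift P n) = E * (a / q) - (a + k * ((E - q) * (E + q)))"
    by (simp add: mink_def inner_add_right pp flip: p_def E_def a_def)
  also have "\<dots> = 0"
    using pos unfolding k_def by (simp add: divide_simps) algebra
  finally show ?thesis .
qed

lemma lift_unlift:
  assumes "mink P X = 0"
  shows "lift P (unlift P X) = X"
proof -
  define q E where "q = sqrt (mink P P)" and "E = fst P"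
  have pos: "q \<noteq> 0" "E + q \<noteq> 0" using sqrt_mink_pos by (simp_all add: q_def E_def)
  have pX: "snd P \<bullet> snd X = E * fst X" using assms by (simp add: mink_def E_def)
  have "snd P \<bullet> unlift P X = E * fst X - (fst X / (E + q)) * ((E - q) * (E + q))"
    unfolding unlift_def by (simp add: inner_simps snd_sq pX flip: q_def E_def)
  also have "\<dots> = fst X * q"
    using pos by (simp add: divide_simps) algebra
  finally have "snd P \<bullet> unlift P X = fst X * q" .
  then show ?thesis
    using pos unfolding lift_def
    by (simp add: prod_eq_iff flip: q_def E_def) (simp add: unlift_def flip: q_def E_def)
qed

end

section \<open>Lorentz boosts of a collision\<close>

definition boost :: "3 \<Rightarrow> real \<Rightarrow> vec4 \<Rightarrow> vec4" where
  "boost j t X = (cosh t * fst X + sinh t * snd X $ j,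
     snd X + ((cosh t - 1) * snd X $ j + sinh t * fst X) *\<^sub>R axis j 1)"

lemma linear_boost: "linear (boost j t)"
  by (rule linearI) (simp_all add: boost_def algebra_simps)

lemma mink_boost: "mink (boost j t X) (boost j t Y) = mink X Y"
proof -
  define x y where "x = snd X $ j" and "y = snd Y $ j"
  define C S where "C = cosh t" and "S = sinh t"
  have CS: "C\<^sup>2 = S\<^sup>2 + 1" by (simp add: C_def S_def cosh_square_eq)
  have "mink (boost j t X) (boost j t Y) =
      (C * fst X + S * x) * (C * fst Y + S * y) - (snd X \<bullet> snd Y
      + ((C - 1) * y + S * fst Y) * x + ((C - 1) * x + S * fst X) * y
      + ((C - 1) * x + S * fst X) * ((C - 1) * y + S * fst Y))"
    by (simp add: mink_def boost_def inner_simps inner_axis inner_axis' flip: x_def y_def C_def S_def)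
       (simp add: algebra_simps)
  also have "\<dots> = fst X * fst Y - snd X \<bullet> snd Y"
    using CS by algebra
  finally show ?thesis by (simp add: mink_def)
qed

lemma boost_0: "boost j 0 X = X"
  by (simp add: boost_def)

lemma boost_boost: "boost j s (boost j t X) = boost j (s + t) X"
  by (simp add: boost_def prod_eq_iff sinh_add cosh_add algebra_simps)

text \<open>
  The action of the boost on the mass shell, which is parametrized by its spatial part.
\<close>

definition boost_mom :: "real \<Rightarrow> 3 \<Rightarrow> real \<Rightarrow> real^3 \<Rightarrow> real^3" where
  "boost_mom c j t v = snd (boost j t (mom4 c v))"

text \<open>
  A boost of rapidity \<open>t\<close> lowers the energy at most by the factor \<open>cosh t - |sinh t|\<close>.
\<close>

lemma fst_boost_ge:
  assumes "\<bar>snd X $ j\<bar> \<le> fst X"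
  shows "exp (- \<bar>t\<bar>) * fst X \<le> fst (boost j t X)"
proof -
  have e: "cosh t - \<bar>sinh t\<bar> = exp (- \<bar>t\<bar>)"
    by (cases "t \<ge> 0") (auto simp: sinh_def cosh_def abs_if field_simps)
  have "- (sinh t * snd X $ j) \<le> \<bar>sinh t\<bar> * \<bar>snd X $ j\<bar>"
    by (simp flip: abs_mult)
  also have "\<dots> \<le> \<bar>sinh t\<bar> * fst X"
    using assms by (intro mult_left_mono) auto
  finally show ?thesis
    unfolding e[symmetric] by (simp add: boost_def algebra_simps)
qed

lemma comp_le_energy: "\<bar>v $ j\<bar> \<le> energy c v"
  using component_le_norm_cart[of v j] norm_le_energy[of v c] by linarith

definition total4 :: "real \<Rightarrow> real^3 \<Rightarrow> real^3 \<Rightarrow> vec4" where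
  "total4 c v u = mom4 c v + mom4 c u"

text \<open>
  The Wigner rotation: leave the rest frame of the pair \<open>(v,u)\<close>, boost, and enter the rest frame of the
  boosted pair. Pure boosts along different directions do not form a group, so this is in general not
  the identity.
\<close>

definition wigner :: "real \<Rightarrow> 3 \<Rightarrow> real \<Rightarrow> real^3 \<Rightarrow> real^3 \<Rightarrow> real^3 \<Rightarrow> real^3" where
  "wigner c j t v u \<omega> = unlift (boost j t (total4 c v u)) (boost j t (lift (total4 c v u) \<omega>))"

context
  fixes c :: real
  assumes c: "c \<ge> 1"
begin

text \<open>
  Boosts preserve the Minkowski product and the sign of the energy of a timelike vector, hence the
  mass shell.
\<close>

lemma boost_mom4: "boost j t (mom4 c v) = mom4 c (boost_mom c j t v)"
  unfolding boost_mom_def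
proof (rule eq_mom4I)
  have "0 \<le> exp (- \<bar>t\<bar>) * energy c v" using energy_pos[OF c, of v] by simp
  also have "\<dots> \<le> fst (boost j t (mom4 c v))"
    using fst_boost_ge[of "mom4 c v" j t] comp_le_energy[of v j c] by simp
  finally show "0 \<le> fst (boost j t (mom4 c v))" .
  show "mink (boost j t (mom4 c v)) (boost j t (mom4 c v)) = c\<^sup>2"
    by (simp add: mink_boost mink_mom4_self)
qed

lemma energy_boost_mom: "energy c (boost_mom c j t v) = cosh t * energy c v + sinh t * v $ j"
  using arg_cong[OF boost_mom4[of j t v], of fst] by (simp add: boost_def)

lemma energy_boost_mom_ge: "exp (- \<bar>t\<bar>) * energy c v \<le> energy c (boost_mom c j t v)"
  using fst_boost_ge[of "mom4 c v" j t] comp_le_energy[of v j c] by (simp add: boost_mom4)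

lemma boost_mom_0: "boost_mom c j 0 v = v"
  by (simp add: boost_mom_def boost_0)

lemma boost_mom_boost_mom: "boost_mom c j s (boost_mom c j t v) = boost_mom c j (s + t) v"
  by (metis boost_boost boost_mom4 boost_mom_def)

lemma bij_boost_mom: "bij (boost_mom c j t)"
  by (rule o_bij[where g = "boost_mom c j (- t)"])
     (simp_all add: fun_eq_iff boost_mom_boost_mom boost_mom_0)

lemma rel_mom_boost: "rel_mom c (boost_mom c j t v) (boost_mom c j t u) = rel_mom c v u"
  by (simp add: rel_mom_eq mink_boost flip: boost_mom4)

lemma mandelstam_s_boost:
  "mandelstam_s c (boost_mom c j t v) (boost_mom c j t u) = mandelstam_s c v u"
  by (simp add: mandelstam_s_rel_mom rel_mom_boost)

lemma total4_pos: "0 < fst (total4 c v u)" "0 < mink (total4 c v u) (total4 c v u)"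
  using energy_pos[OF c, of v] energy_pos[OF c, of u] mandelstam_s_pos[OF c, of v u]
  by (simp_all add: total4_def mandelstam_s_eq)

lemma boost_total4: "boost j t (total4 c v u) = total4 c (boost_mom c j t v) (boost_mom c j t u)"
  by (simp add: total4_def boost_mom4 linear_add[OF linear_boost])

lemma boosted_dir_lift: "boosted_dir c v u \<omega> = snd (lift (total4 c v u) \<omega>)"
  by (simp add: boosted_dir_def lift_def mandelstam_s_eq total4_def)

text \<open>
  Positivity of the outgoing energies: each differs from half of the total energy by at most half of
  the total energy, because \<open>g \<le> sqrt s\<close> and the total momentum is at most the total energy.
\<close>

lemma lift_energy_bound:
  assumes "norm \<omega> = 1"
  shows "\<bar>rel_mom c v u * fst (lift (total4 c v u) \<omega>)\<bar> \<le> fst (total4 c v u)"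
proof -
  let ?P = "total4 c v u" and ?q = "sqrt (mandelstam_s c v u)"
  have q: "0 < ?q" using mandelstam_s_pos[OF c] by simp
  have fst_lift: "fst (lift ?P \<omega>) = (snd ?P \<bullet> \<omega>) / ?q"
    by (simp add: lift_def total4_def mandelstam_s_eq)
  have "rel_mom c v u \<le> ?q"
    by (rule real_le_rsqrt) (simp add: mandelstam_s_rel_mom)
  moreover have "\<bar>snd ?P \<bullet> \<omega>\<bar> \<le> norm (snd ?P)"
    using Cauchy_Schwarz_ineq2[of "snd ?P" \<omega>] assms by simp
  ultimately have "rel_mom c v u * \<bar>snd ?P \<bullet> \<omega>\<bar> \<le> ?q * norm (snd ?P)"
    using q by (intro mult_mono) auto
  then have "\<bar>rel_mom c v u * fst (lift ?P \<omega>)\<bar> \<le> norm (snd ?P)"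
    using q rel_mom_nonneg[of c v u]
    by (simp add: fst_lift abs_mult pos_divide_le_eq mult.commute)
  also have "norm (snd ?P) \<le> norm v + norm u"
    by (simp add: total4_def norm_triangle_ineq)
  also have "\<dots> \<le> fst ?P"
    using norm_le_energy[of v c] norm_le_energy[of u c] by (simp add: total4_def)
  finally show ?thesis .
qed

text \<open>
  In the centre-of-momentum frame a collision replaces the relative momentum by a vector of the same
  length \<open>g\<close> in the direction \<open>\<omega>\<close>. Both right-hand sides have Minkowski square
  \<open>(s - g\<^sup>2) / 4 = c\<^sup>2\<close>, so they lie on the mass shell.
\<close>

lemma mom4_post:
  assumes \<omega>: "norm \<omega> = 1"
  shows mom4_post_v: "mom4 c (post_v c v u \<omega>) =
      (1/2) *\<^sub>R (total4 c v u + rel_mom c v u *\<^sub>R lift (total4 c v u) \<omega>)" (is "_ = ?V")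
    and mom4_post_u: "mom4 c (post_u c v u \<omega>) =
      (1/2) *\<^sub>R (total4 c v u - rel_mom c v u *\<^sub>R lift (total4 c v u) \<omega>)" (is "_ = ?U")
proof -
  let ?P = "total4 c v u" and ?g = "rel_mom c v u"
  have PP: "mink ?P ?P = ?g\<^sup>2 + 4 * c\<^sup>2"
    by (simp add: total4_def flip: mandelstam_s_eq mandelstam_s_rel_mom)
  have LL: "mink (lift ?P \<omega>) (lift ?P \<omega>) = - 1"
    using \<omega> by (simp add: mink_lift_lift total4_pos dot_square_norm)
  have PL: "mink ?P (lift ?P \<omega>) = 0" "mink (lift ?P \<omega>) ?P = 0"
    using mink_total_lift[OF total4_pos] by (simp_all add: mink_commute)
  have "?V = mom4 c (snd ?V)"
  proof (rule eq_mom4I)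
    show "0 \<le> fst ?V" using lift_energy_bound[OF \<omega>, of v u] by simp
    show "mink ?V ?V = c\<^sup>2"
      by (simp add: mink_simps PP LL PL) (simp add: power2_eq_square field_simps)
  qed
  moreover have "snd ?V = post_v c v u \<omega>"
    by (simp add: post_v_def boosted_dir_lift scaleR_add_right) (simp add: total4_def scaleR_add_right)
  ultimately show "mom4 c (post_v c v u \<omega>) = ?V" by simp
  have "?U = mom4 c (snd ?U)"
  proof (rule eq_mom4I)
    show "0 \<le> fst ?U" using lift_energy_bound[OF \<omega>, of v u] by simp
    show "mink ?U ?U = c\<^sup>2"
      by (simp add: mink_simps PP LL PL) (simp add: power2_eq_square field_simps)
  qed
  moreover have "snd ?U = post_u c v u \<omega>"
    by (simp add: post_u_def boosted_dir_lift scaleR_diff_right) (simp add: total4_def scaleR_add_right)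
  ultimately show "mom4 c (post_u c v u \<omega>) = ?U" by simp
qed

lemma energy_conservation:
  assumes "norm \<omega> = 1"
  shows "energy c (post_v c v u \<omega>) + energy c (post_u c v u \<omega>) = energy c v + energy c u"
  using arg_cong[OF mom4_post_v[OF assms, of v u], of fst] arg_cong[OF mom4_post_u[OF assms, of v u], of fst]
  by (simp add: total4_def)

lemma lift_wigner:
  "lift (boost j t (total4 c v u)) (wigner c j t v u \<omega>) = boost j t (lift (total4 c v u) \<omega>)"
  unfolding wigner_def
proof (rule lift_unlift)
  show "0 < fst (boost j t (total4 c v u))" "0 < mink (boost j t (total4 c v u)) (boost j t (total4 c v u))"
    unfolding boost_total4 by (rule total4_pos)+
  show "mink (boost j t (total4 c v u)) (boost j t (lift (total4 c v u) \<omega>)) = 0"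
    by (simp add: mink_boost mink_total_lift[OF total4_pos])
qed

text \<open>
  It is a composition of three isometries: space to the orthogonal complement of the total momentum,
  that complement to the one of the boosted total momentum, and back to space.
\<close>

lemma orthogonal_wigner: "orthogonal_transformation (wigner c j t v u)"
  unfolding orthogonal_transformation_def
proof (intro conjI allI)
  have "linear (unlift (boost j t (total4 c v u)) \<circ> (boost j t \<circ> lift (total4 c v u)))"
    by (intro linear_compose linear_lift linear_boost linear_unlift)
  then show "linear (wigner c j t v u)"
    by (simp add: wigner_def[abs_def] o_def)
  fix m n
  have "wigner c j t v u m \<bullet> wigner c j t v u n =
      - mink (lift (boost j t (total4 c v u)) (wigner c j t v u m))
             (lift (boost j t (total4 c v u)) (wigner c j t v u n))"
    unfolding boost_total4 by (simp add: mink_lift_lift[OF total4_pos])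
  also have "\<dots> = m \<bullet> n"
    unfolding lift_wigner by (simp add: mink_boost mink_lift_lift[OF total4_pos])
  finally show "wigner c j t v u m \<bullet> wigner c j t v u n = m \<bullet> n" .
qed

text \<open>
  By construction of the Wigner rotation, lifting the rotated direction in the boosted frame is the same
  as boosting the lifted direction; apply this to the description of the outgoing momenta by lifts.
\<close>

lemma post_boost:
  assumes \<omega>: "norm \<omega> = 1"
  shows post_v_boost: "post_v c (boost_mom c j t v) (boost_mom c j t u) (wigner c j t v u \<omega>)
      = boost_mom c j t (post_v c v u \<omega>)"
    and post_u_boost: "post_u c (boost_mom c j t v) (boost_mom c j t u) (wigner c j t v u \<omega>)
      = boost_mom c j t (post_u c v u \<omega>)"
proof -
  have W: "norm (wigner c j t v u \<omega>) = 1"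
    using orthogonal_transformation_norm[OF orthogonal_wigner] \<omega> by simp
  have "mom4 c (post_v c (boost_mom c j t v) (boost_mom c j t u) (wigner c j t v u \<omega>)) =
      boost j t (mom4 c (post_v c v u \<omega>))"
    by (simp add: mom4_post_v[OF W] mom4_post_v[OF \<omega>] rel_mom_boost flip: boost_total4)
       (simp add: lift_wigner linear_cmul[OF linear_boost] linear_add[OF linear_boost])
  then show "post_v c (boost_mom c j t v) (boost_mom c j t u) (wigner c j t v u \<omega>)
      = boost_mom c j t (post_v c v u \<omega>)"
    by (metis boost_mom_def mom4_simps(2))
  have "mom4 c (post_u c (boost_mom c j t v) (boost_mom c j t u) (wigner c j t v u \<omega>)) =
      boost j t (mom4 c (post_u c v u \<omega>))"
    by (simp add: mom4_post_u[OF W] mom4_post_u[OF \<omega>] rel_mom_boost flip: boost_total4)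
       (simp add: lift_wigner linear_cmul[OF linear_boost] linear_diff[OF linear_boost])
  then show "post_u c (boost_mom c j t v) (boost_mom c j t u) (wigner c j t v u \<omega>)
      = boost_mom c j t (post_u c v u \<omega>)"
    by (metis boost_mom_def mom4_simps(2))
qed

lemma cos_scatter_mink:
  "cos_scatter c v u \<omega> = - mink (mom4 c v - mom4 c u)
     (mom4 c (post_v c v u \<omega>) - mom4 c (post_u c v u \<omega>)) / (rel_mom c v u)\<^sup>2"
  by (simp add: cos_scatter_def mink_def algebra_simps)

lemma cos_scatter_boost:
  assumes "norm \<omega> = 1"
  shows "cos_scatter c (boost_mom c j t v) (boost_mom c j t u) (wigner c j t v u \<omega>) = cos_scatter c v u \<omega>"
  by (simp add: cos_scatter_mink post_v_boost[OF assms] post_u_boost[OF assms] rel_mom_boost mink_boost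
      flip: boost_mom4 linear_diff[OF linear_boost])

text \<open>
  In the centre-of-momentum frame the quotient is a cosine between two Euclidean vectors: the
  difference \<open>v - u\<close> of the four-momenta is orthogonal to the total momentum, hence the lift of a
  vector \<open>n\<close> of length \<open>g\<close>, and the outgoing difference is the lift of \<open>g \<omega>\<close>. For \<open>g = 0\<close> the
  quotient is \<open>0\<close> by convention.
\<close>

lemma abs_cos_scatter_le_1:
  assumes \<omega>: "norm \<omega> = 1"
  shows "\<bar>cos_scatter c v u \<omega>\<bar> \<le> 1"
proof -
  let ?P = "total4 c v u" and ?g = "rel_mom c v u" and ?D = "mom4 c v - mom4 c u"
  define n where "n = unlift ?P ?D"
  have "mink ?P ?D = 0"
    by (simp add: total4_def mink_simps mink_mom4_self mink_commute)
  then have D: "?D = lift ?P n"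
    unfolding n_def by (rule lift_unlift[OF total4_pos, symmetric])
  have "n \<bullet> n = - mink ?D ?D"
    unfolding D by (simp add: mink_lift_lift[OF total4_pos])
  also have "\<dots> = ?g\<^sup>2"
    by (simp add: mink_simps mink_mom4_self rel_mom_sq mink_commute)
  finally have n: "norm n = ?g"
    by (simp add: norm_eq_sqrt_inner rel_mom_nonneg)
  have "mom4 c (post_v c v u \<omega>) - mom4 c (post_u c v u \<omega>) = ?g *\<^sub>R lift ?P \<omega>"
    by (simp add: mom4_post_v[OF \<omega>] mom4_post_u[OF \<omega>] scaleR_diff_right scaleR_add_right
        flip: scaleR_left_distrib)
  then have "cos_scatter c v u \<omega> = ?g * (n \<bullet> \<omega>) / ?g\<^sup>2"
    unfolding cos_scatter_mink D by (simp add: mink_simps mink_lift_lift[OF total4_pos])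
  also have "\<bar>\<dots>\<bar> \<le> 1"
  proof (cases "?g = 0")
    case False
    then have "?g > 0" using rel_mom_nonneg[of c v u] by simp
    moreover have "\<bar>n \<bullet> \<omega>\<bar> \<le> ?g"
      using Cauchy_Schwarz_ineq2[of n \<omega>] \<omega> n by simp
    ultimately show ?thesis
      by (simp add: abs_mult power2_eq_square divide_simps)
  qed simp
  finally show ?thesis .
qed

text \<open>
  The kernel depends on Lorentz invariants only, up to the factor \<open>1 / (v\<^sub>0 u\<^sub>0)\<close> of the Moller velocity.
\<close>

lemma coll_kernel_boost:
  assumes "norm \<omega> = 1"
  shows "energy c (boost_mom c j t v) * energy c (boost_mom c j t u) *
      coll_kernel c \<gamma> \<sigma> (boost_mom c j t v) (boost_mom c j t u) (wigner c j t v u \<omega>) =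
    energy c v * energy c u * coll_kernel c \<gamma> \<sigma> v u \<omega>"
  using energy_pos[OF c, of v] energy_pos[OF c, of u]
    energy_pos[OF c, of "boost_mom c j t v"] energy_pos[OF c, of "boost_mom c j t u"]
  by (simp add: coll_kernel_def moller_vel_def cos_scatter_boost[OF assms] rel_mom_boost mandelstam_s_boost)

end

section \<open>Boosts as changes of variables and as flows\<close>

lemma has_derivative_energy:
  assumes "c \<ge> 1"
  shows "(energy c has_derivative (\<lambda>y. (v \<bullet> y) / energy c v)) (at v)"
proof -
  have pos: "0 < c\<^sup>2 + v \<bullet> v"
    using assms by (simp add: add_pos_nonneg)
  have "((\<lambda>x. sqrt (c\<^sup>2 + x \<bullet> x)) has_derivative
      (\<lambda>y. (v \<bullet> y + y \<bullet> v) * (inverse (sqrt (c\<^sup>2 + v \<bullet> v)) / 2))) (at v)"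
    by (rule derivative_eq_intros refl | use pos in simp)+
  moreover have "energy c = (\<lambda>x. sqrt (c\<^sup>2 + x \<bullet> x))"
    by (simp add: fun_eq_iff energy_def power2_norm_eq_inner)
  moreover have "(v \<bullet> y + y \<bullet> v) * (inverse r / 2) = v \<bullet> y / r" for y r
    by (cases "r = 0") (simp_all add: inner_commute field_simps)
  ultimately show ?thesis by simp
qed

lemma det_id_plus_rank_one:
  fixes a :: "real^3"
  shows "det (matrix (\<lambda>y. y + (a \<bullet> y) *\<^sub>R axis j 1)) = 1 + a $ j"
proof -
  have "matrix (\<lambda>y. y + (a \<bullet> y) *\<^sub>R axis j 1) = (\<chi> i k. axis k 1 $ i + a $ k * axis j 1 $ i)"
    by (simp add: matrix_def inner_axis)
  then show ?thesis
    using exhaust_3[of j] by (auto simp: det_3 axis_def algebra_simps)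
qed

context
  fixes c :: real
  assumes c: "c \<ge> 1"
begin

text \<open>
  The derivative of the boost is a rank-one perturbation of the identity, and this is the gradient
  of its coefficient.
\<close>

definition boost_grad :: "3 \<Rightarrow> real \<Rightarrow> real^3 \<Rightarrow> real^3" where
  "boost_grad j t v = (cosh t - 1) *\<^sub>R axis j 1 + (sinh t / energy c v) *\<^sub>R v"

lemma boost_mom_eq:
  "boost_mom c j t v = v + ((cosh t - 1) * v $ j + sinh t * energy c v) *\<^sub>R axis j 1"
  by (simp add: boost_mom_def boost_def)

lemma has_derivative_boost_mom:
  "(boost_mom c j t has_derivative (\<lambda>y. y + (boost_grad j t v \<bullet> y) *\<^sub>R axis j 1)) (at v)"
proof -
  have comp: "((\<lambda>x. x $ j) has_derivative (\<lambda>y. y $ j)) (at v)"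
    by (rule bounded_linear_imp_has_derivative) (rule bounded_linear_vec_nth)
  show ?thesis
    unfolding boost_mom_eq[abs_def]
    by (rule derivative_eq_intros comp has_derivative_energy[OF c] refl)+
       (simp add: fun_eq_iff boost_grad_def inner_simps inner_axis' algebra_simps)
qed

text \<open>
  The invariance of the measure \<open>du / u\<^sub>0\<close>, in infinitesimal form.
\<close>

lemma det_boost_mom:
  "det (matrix (\<lambda>y. y + (boost_grad j t v \<bullet> y) *\<^sub>R axis j 1)) = energy c (boost_mom c j t v) / energy c v"
  using energy_pos[OF c, of v]
  unfolding det_id_plus_rank_one
  by (simp add: boost_grad_def energy_boost_mom[OF c] axis_def field_simps)

lemma continuous_boost_mom: "continuous_on UNIV (boost_mom c j t)"
  using has_derivative_boost_mom by (blast intro: has_derivative_continuous continuous_at_imp_continuous_on)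

lemma measurable_boost_mom [measurable]: "boost_mom c j t \<in> borel \<rightarrow>\<^sub>M borel"
  by (rule borel_measurable_continuous_onI[OF continuous_boost_mom])

text \<open>
  Boosted momenta are the integral curves of the vector field \<open>v\<^sub>0 e\<^sub>j\<close>.
\<close>

lemma boost_mom_has_vector_derivative:
  "((\<lambda>t. boost_mom c j t x) has_vector_derivative energy c (boost_mom c j t x) *\<^sub>R axis j 1) (at t)"
  unfolding boost_mom_eq energy_boost_mom[OF c, unfolded boost_mom_eq]
  by (auto intro!: derivative_eq_intros simp: algebra_simps)

end

section \<open>Measurability of the collision kernel\<close>

lemma measurable_sphere_measure_id [measurable]: "(\<lambda>x. x) \<in> sphere_measure \<rightarrow>\<^sub>M borel"
  unfolding measurable_cong_sets[OF sets_sphere_measure refl]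
  by (rule measurable_restrict_space1) simp

lemma norm_sphere_measure: "\<omega> \<in> space sphere_measure \<Longrightarrow> norm \<omega> = 1"
  by (simp add: space_sphere_measure)

lemma measurable_collision [measurable]:
  assumes [measurable]: "V \<in> M \<rightarrow>\<^sub>M borel" "U \<in> M \<rightarrow>\<^sub>M borel" "W \<in> M \<rightarrow>\<^sub>M borel"
  shows measurable_rel_mom: "(\<lambda>x. rel_mom c (V x) (U x)) \<in> borel_measurable M"
    and measurable_mandelstam_s: "(\<lambda>x. mandelstam_s c (V x) (U x)) \<in> borel_measurable M"
    and measurable_moller_vel: "(\<lambda>x. moller_vel c (V x) (U x)) \<in> borel_measurable M"
    and measurable_post_v: "(\<lambda>x. post_v c (V x) (U x) (W x)) \<in> borel_measurable M"
    and measurable_post_u: "(\<lambda>x. post_u c (V x) (U x) (W x)) \<in> borel_measurable M"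
proof -
  show g[measurable]: "(\<lambda>x. rel_mom c (V x) (U x)) \<in> borel_measurable M"
    unfolding rel_mom_def by measurable
  show s[measurable]: "(\<lambda>x. mandelstam_s c (V x) (U x)) \<in> borel_measurable M"
    unfolding mandelstam_s_def by measurable
  show "(\<lambda>x. moller_vel c (V x) (U x)) \<in> borel_measurable M"
    unfolding moller_vel_def by measurable
  show "(\<lambda>x. post_v c (V x) (U x) (W x)) \<in> borel_measurable M"
    unfolding post_v_def boosted_dir_def by measurable
  show "(\<lambda>x. post_u c (V x) (U x) (W x)) \<in> borel_measurable M"
    unfolding post_u_def boosted_dir_def by measurable
qed

lemma measurable_cos_scatter [measurable]:
  assumes [measurable]: "V \<in> M \<rightarrow>\<^sub>M borel" "U \<in> M \<rightarrow>\<^sub>M borel" "W \<in> M \<rightarrow>\<^sub>M borel"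
  shows "(\<lambda>x. cos_scatter c (V x) (U x) (W x)) \<in> borel_measurable M"
  unfolding cos_scatter_def by measurable

text \<open>
  The angular part is measurable on the interval from \<open>0\<close> to \<open>pi\<close> only, and the arc cosine is
  meaningful between \<open>-1\<close> and \<open>1\<close>. Both are replaced by total Borel functions, which changes nothing
  because the cosine of the scattering angle has absolute value at most \<open>1\<close> for unit vectors.
\<close>

lemma measurable_coll_kernel:
  assumes c: "c \<ge> 1" and \<sigma>: "\<sigma> \<in> borel_measurable (restrict_space borel {0..pi})"
    and [measurable]: "V \<in> M \<rightarrow>\<^sub>M borel" "U \<in> M \<rightarrow>\<^sub>M borel" "W \<in> M \<rightarrow>\<^sub>M borel"
    and W: "\<And>x. x \<in> space M \<Longrightarrow> norm (W x) = 1"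
  shows "(\<lambda>x. coll_kernel c \<gamma> \<sigma> (V x) (U x) (W x)) \<in> borel_measurable M"
proof -
  define \<sigma>' where "\<sigma>' \<theta> = indicator {0..pi} \<theta> *\<^sub>R \<sigma> \<theta>" for \<theta>
  have \<sigma>'[measurable]: "\<sigma>' \<in> borel_measurable borel"
    using \<sigma> unfolding \<sigma>'_def[abs_def] by (subst (asm) borel_measurable_restrict_space_iff) auto
  define ac where "ac x = arccos (max (-1) (min 1 x))" for x :: real
  have ac[measurable]: "ac \<in> borel_measurable borel"
    unfolding ac_def[abs_def] by (intro borel_measurable_continuous_onI continuous_intros) auto
  have "(\<lambda>x. moller_vel c (V x) (U x) * (\<bar>rel_mom c (V x) (U x)\<bar> powr (\<gamma> - 1) *
      \<sigma>' (ac (cos_scatter c (V x) (U x) (W x))))) \<in> borel_measurable M"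
    by measurable
  also have "?this \<longleftrightarrow> ?thesis"
  proof (rule measurable_cong)
    fix x assume "x \<in> space M"
    then have "\<bar>cos_scatter c (V x) (U x) (W x)\<bar> \<le> 1"
      by (intro abs_cos_scatter_le_1[OF c] W)
    moreover from this have "ac (cos_scatter c (V x) (U x) (W x)) = arccos (cos_scatter c (V x) (U x) (W x))"
      unfolding ac_def by (intro arg_cong[where f = arccos]) linarith
    ultimately have "\<sigma>' (ac (cos_scatter c (V x) (U x) (W x))) = \<sigma> (arccos (cos_scatter c (V x) (U x) (W x)))"
      by (simp add: \<sigma>'_def abs_le_iff arccos_lbound arccos_ubound)
    then show "moller_vel c (V x) (U x) * (\<bar>rel_mom c (V x) (U x)\<bar> powr (\<gamma> - 1) *
      \<sigma>' (ac (cos_scatter c (V x) (U x) (W x)))) = coll_kernel c \<gamma> \<sigma> (V x) (U x) (W x)"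
      by (simp add: coll_kernel_def cross_section_def)
  qed
  finally show ?thesis .
qed

section \<open>Size of the kernel and decay of the distribution functions\<close>

text \<open>
  From \<open>g\<^sup>2 = |v - w|\<^sup>2 - (v\<^sub>0 - w\<^sub>0)\<^sup>2\<close> and \<open>(v\<^sub>0 - w\<^sub>0) (v\<^sub>0 + w\<^sub>0) = (v - w) \<bullet> (v + w)\<close>, Cauchy--Schwarz
  gives \<open>g\<^sup>2 (v\<^sub>0 + w\<^sub>0)\<^sup>2 \<ge> |v - w|\<^sup>2 s\<close>. For fixed \<open>v\<close> the invariant \<open>s\<close> grows at least like \<open>w\<^sub>0\<close>.
\<close>

lemma rel_mom_lower:
  assumes c: "c \<ge> 1"
  shows "(energy c v - norm v) / (2 * (energy c v)\<^sup>2) * (norm (v - w))\<^sup>2 / energy c w \<le> (rel_mom c v w)\<^sup>2"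
proof -
  define v0 w0 d e where "v0 = energy c v" and "w0 = energy c w" and "d = norm (v - w)"
    and "e = v0 - norm v"
  have v0: "1 \<le> v0" and w0: "1 \<le> w0"
    using c_le_energy[of c v] c_le_energy[of c w] c by (simp_all add: v0_def w0_def)
  have vn: "0 < v0 - norm v" using norm_less_energy[OF c, of v] by (simp add: v0_def)
  have sq: "v0\<^sup>2 = c\<^sup>2 + v \<bullet> v" "w0\<^sup>2 = c\<^sup>2 + w \<bullet> w"
    by (simp_all add: v0_def w0_def energy_sq)
  have g: "(rel_mom c v w)\<^sup>2 = d\<^sup>2 - (v0 - w0)\<^sup>2"
    unfolding rel_mom_sq d_def power2_norm_eq_inner
    using sq by (simp add: mink_def v0_def w0_def inner_simps inner_commute power2_diff)
  have s: "mandelstam_s c v w = (v0 + w0)\<^sup>2 - (norm (v + w))\<^sup>2"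
    unfolding mandelstam_s_def power2_norm_eq_inner
    using sq by (simp add: v0_def w0_def inner_simps inner_commute power2_sum)
  have "(v0 - w0) * (v0 + w0) = (v - w) \<bullet> (v + w)"
    using sq by (simp add: inner_simps inner_commute algebra_simps power2_eq_square)
  then have "((v0 - w0) * (v0 + w0))\<^sup>2 \<le> (d * norm (v + w))\<^sup>2"
    using Cauchy_Schwarz_ineq2[of "v - w" "v + w"] by (simp add: d_def abs_le_square_iff[symmetric] abs_mult)
  then have gs: "d\<^sup>2 * mandelstam_s c v w \<le> (rel_mom c v w)\<^sup>2 * (v0 + w0)\<^sup>2"
    unfolding g s power_mult_distrib by (simp add: left_diff_distrib right_diff_distrib)
  have "v \<bullet> w \<le> norm v * w0"
    using norm_cauchy_schwarz[of v w] mult_left_mono[OF norm_le_energy[of w c] norm_ge_zero[of v]]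
    by (simp add: w0_def)
  then have "2 * e * w0 \<le> mandelstam_s c v w"
    using zero_le_power2[of c] unfolding mandelstam_s_def v0_def[symmetric] w0_def[symmetric] e_def
    by (simp only: left_diff_distrib right_diff_distrib mult.assoc distrib_left)
  then have "d\<^sup>2 * (2 * e * w0) \<le> (rel_mom c v w)\<^sup>2 * (v0 + w0)\<^sup>2"
    using gs by (meson mult_left_mono order_trans zero_le_power2)
  also have "\<dots> \<le> (rel_mom c v w)\<^sup>2 * (2 * v0 * w0)\<^sup>2"
  proof (intro mult_left_mono power_mono)
    have "0 \<le> (v0 - 1) * w0 + (w0 - 1) * v0" using v0 w0 by simp
    then show "v0 + w0 \<le> 2 * v0 * w0" by (simp add: algebra_simps)
  qed (use v0 w0 in auto)
  finally have "d\<^sup>2 * (2 * e * w0) \<le> (rel_mom c v w)\<^sup>2 * (2 * v0 * w0)\<^sup>2" .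
  then have "w0 * (d\<^sup>2 * 2 * e) \<le> w0 * ((rel_mom c v w)\<^sup>2 * 4 * v0\<^sup>2 * w0)"
    by (simp add: power2_eq_square mult_ac)
  then have "d\<^sup>2 * 2 * e \<le> (rel_mom c v w)\<^sup>2 * 4 * v0\<^sup>2 * w0"
    by (rule mult_left_le_imp_le) (use w0 in simp)
  then have "e * d\<^sup>2 \<le> (rel_mom c v w)\<^sup>2 * (2 * v0\<^sup>2 * w0)"
    by (simp add: mult_ac)
  then have "e * d\<^sup>2 / (2 * v0\<^sup>2 * w0) \<le> (rel_mom c v w)\<^sup>2"
    using v0 w0 by (simp add: pos_divide_le_eq)
  then show ?thesis
    by (simp flip: v0_def w0_def d_def e_def)
qed

text \<open>
  Replacing \<open>w\<close> by \<open>-w\<close> keeps the energy and reverses the inner product, so the bound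
  \<open>mink_mom4_ge\<close> controls \<open>c\<^sup>2 - v \<bullet> w\<close> as well.
\<close>

lemma mandelstam_s_upper: "mandelstam_s c v w \<le> 4 * (energy c v * energy c w)"
  using mink_mom4_ge[of c v "- w"] by (simp add: mandelstam_s_def mink_def energy_def)

text \<open>
  The kernel is \<open>sqrt s * (g powr \<gamma>) / w\<^sub>0\<close> up to bounded factors. Since \<open>\<gamma> \<le> 0\<close>, the lower bound on
  \<open>g\<close> turns into an upper bound on its power.
\<close>

lemma coll_kernel_bound:
  assumes c: "c \<ge> 1" and \<gamma>: "\<gamma> \<le> 0" and S: "\<And>\<theta>. \<theta> \<in> {0..pi} \<Longrightarrow> \<bar>\<sigma> \<theta>\<bar> \<le> S"
  obtains C where "0 \<le> C"
    and "\<And>w \<omega>. norm \<omega> = 1 \<Longrightarrow> \<bar>energy c v * coll_kernel c \<gamma> \<sigma> v w \<omega>\<bar>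
           \<le> C * norm (v - w) powr \<gamma> * energy c w powr (- (\<gamma> / 2 + 1 / 2))"
proof -
  define v0 b where "v0 = energy c v" and "b = (v0 - norm v) / (2 * v0\<^sup>2)"
  have v0: "0 < v0" using energy_pos[OF c] by (simp add: v0_def)
  have b: "0 < b" using norm_less_energy[OF c, of v] v0 by (simp add: b_def v0_def)
  have S0: "0 \<le> S" using S[of 0] by simp
  define C where "C = c * sqrt v0 / 2 * b powr (\<gamma> / 2) * S"
  have C0: "0 \<le> C" using c v0 S0 by (simp add: C_def)
  have "\<bar>energy c v * coll_kernel c \<gamma> \<sigma> v w \<omega>\<bar>
      \<le> C * norm (v - w) powr \<gamma> * energy c w powr (- (\<gamma> / 2 + 1 / 2))" if \<omega>: "norm \<omega> = 1" for w \<omega>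
  proof (cases "w = v")
    case True
    have "rel_mom c v v = 0" using rel_mom_sq[of c v v] by (simp add: mink_mom4_self)
    then show ?thesis by (simp add: True coll_kernel_def moller_vel_def)
  next
    case False
    define w0 g d where "w0 = energy c w" and "g = rel_mom c v w" and "d = norm (v - w)"
    have w0: "0 < w0" using energy_pos[OF c] by (simp add: w0_def)
    have d: "0 < d" using False by (simp add: d_def)
    have low: "b * d\<^sup>2 / w0 \<le> g\<^sup>2"
      using rel_mom_lower[OF c, of v w] by (simp add: b_def v0_def w0_def d_def g_def)
    have "0 < b * d\<^sup>2 / w0" using b d w0 by simp
    then have "g \<noteq> 0" using low by auto
    then have g: "0 < g" using rel_mom_nonneg[of c v w] by (simp add: g_def)
    have "g powr \<gamma> = (g\<^sup>2) powr (\<gamma> / 2)"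
      using powr_powr[of g 2 "\<gamma> / 2"] g by simp
    also have "\<dots> \<le> (b * d\<^sup>2 / w0) powr (\<gamma> / 2)"
      using low b d w0 \<gamma> by (intro powr_mono2') auto
    also have "\<dots> = b powr (\<gamma> / 2) * d powr \<gamma> * w0 powr (- (\<gamma> / 2))"
      using powr_powr[of d 2 "\<gamma> / 2"] b d w0 by (simp add: powr_mult powr_divide powr_minus_divide)
    finally have gg: "g powr \<gamma> \<le> b powr (\<gamma> / 2) * d powr \<gamma> * w0 powr (- (\<gamma> / 2))" .
    have ss: "sqrt (mandelstam_s c v w) \<le> 2 * sqrt v0 * sqrt w0"
    proof (rule real_le_lsqrt)
      show "mandelstam_s c v w \<le> (2 * sqrt v0 * sqrt w0)\<^sup>2"
        using mandelstam_s_upper[of c v w] v0 w0 by (simp add: power_mult_distrib v0_def w0_def)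
    qed (use v0 w0 in auto)
    have sg: "\<bar>\<sigma> (arccos (cos_scatter c v w \<omega>))\<bar> \<le> S"
      using abs_cos_scatter_le_1[OF c \<omega>, of v w]
      by (intro S) (simp add: abs_le_iff arccos_lbound arccos_ubound)
    have gp: "g * g powr (\<gamma> - 1) = g powr \<gamma>"
      using g by (simp add: powr_diff)
    have "\<bar>energy c v * coll_kernel c \<gamma> \<sigma> v w \<omega>\<bar> =
        \<bar>c / (4 * w0) * sqrt (mandelstam_s c v w) * (g * g powr (\<gamma> - 1)) * \<sigma> (arccos (cos_scatter c v w \<omega>))\<bar>"
      using v0 w0 g by (simp add: coll_kernel_def moller_vel_def cross_section_def mult_ac flip: v0_def w0_def g_def)
    also have "\<dots> = c / (4 * w0) * sqrt (mandelstam_s c v w) * g powr \<gamma> * \<bar>\<sigma> (arccos (cos_scatter c v w \<omega>))\<bar>"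
      using c w0 mandelstam_s_pos[OF c, of v w] by (simp add: gp abs_mult)
    also have "\<dots> \<le> c / (4 * w0) * (2 * sqrt v0 * sqrt w0) * (b powr (\<gamma> / 2) * d powr \<gamma> * w0 powr (- (\<gamma> / 2))) * S"
      using c w0 v0 mandelstam_s_pos[OF c, of v w]
      by (intro mult_mono ss gg sg) (auto intro!: mult_nonneg_nonneg)
    also have "\<dots> = C * d powr \<gamma> * (sqrt w0 / w0 * w0 powr (- (\<gamma> / 2)))"
      by (simp add: C_def mult_ac)
    also have "sqrt w0 / w0 = w0 powr (- (1 / 2))"
      using w0 by (simp add: powr_minus powr_half_sqrt real_div_sqrt inverse_eq_divide field_simps)
    also have "w0 powr (- (1 / 2)) * w0 powr (- (\<gamma> / 2)) = w0 powr (- (\<gamma> / 2 + 1 / 2))"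
      by (simp add: powr_add[symmetric] algebra_simps)
    finally show ?thesis by (simp add: d_def w0_def)
  qed
  with C0 show ?thesis by (rule that)
qed

text \<open>
  The decay hypothesis measured by the energy, which a boost changes by a bounded factor.
\<close>

definition energy_decay :: "real \<Rightarrow> real \<Rightarrow> real \<Rightarrow> (real^3 \<Rightarrow> real) \<Rightarrow> bool" where
  "energy_decay c k C f \<longleftrightarrow> (\<forall>x. \<bar>f x\<bar> \<le> C * energy c x powr (- k))"

lemma energy_decay_weaken:
  assumes c: "c \<ge> 1" and f: "energy_decay c k C f" and "k' \<le> k" "C \<le> C'"
  shows "energy_decay c k' C' f"
  unfolding energy_decay_def
proof
  fix x
  have "1 \<le> energy c x" using c_le_energy[of c x] c by linarith
  then have e: "energy c x powr (- k) \<le> energy c x powr (- k')"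
    using assms by (intro powr_mono) auto
  have "\<bar>f x\<bar> \<le> C * energy c x powr (- k)" using f by (simp add: energy_decay_def)
  also have "\<dots> \<le> C' * energy c x powr (- k)" using assms by (intro mult_right_mono) auto
  also have "\<dots> \<le> C' * energy c x powr (- k')"
  proof (intro mult_left_mono e)
    show "0 \<le> C'"
      using f assms(4) energy_pos[OF c, of 0] unfolding energy_decay_def
      by (smt (verit) mult_nonneg_nonneg powr_gt_zero zero_less_mult_pos2 mult_neg_pos)
  qed
  finally show "\<bar>f x\<bar> \<le> C' * energy c x powr (- k')" .
qed

lemma decays_imp_energy_decay:
  assumes c: "c \<ge> 1" and "-5 < \<gamma>" and f: "decays \<gamma> f"
  shows "\<exists>k > (\<gamma> + 5) / 2. \<exists>C. energy_decay c k C f"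
proof -
  obtain k C where k: "k > (\<gamma> + 5) / 2" and f: "\<And>x. \<bar>f x\<bar> \<le> C * (1 + norm x) powr (- k)"
    using f unfolding decays_def by blast
  have C: "0 \<le> C" using f[of 0] by simp
  have "\<bar>f x\<bar> \<le> C * c powr k * energy c x powr (- k)" for x
  proof -
    have "(1 + norm x) powr (- k) \<le> (energy c x / c) powr (- k)"
      using energy_le[OF c, of x] energy_pos[OF c, of x] c k assms(2)
      by (intro powr_mono2') (auto simp: field_simps)
    also have "\<dots> = c powr k * energy c x powr (- k)"
      using c energy_pos[OF c, of x] by (simp add: powr_divide powr_minus_divide)
    finally have "C * (1 + norm x) powr (- k) \<le> C * (c powr k * energy c x powr (- k))"
      using C by (rule mult_left_mono)
    then show ?thesis using f[of x] by (simp add: mult.assoc)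
  qed
  then show ?thesis using k unfolding energy_decay_def by blast
qed

lemma energy_decay_boost:
  assumes c: "c \<ge> 1" and f: "energy_decay c k C f" and C: "0 \<le> C" and k: "0 \<le> k" and t: "\<bar>t\<bar> \<le> 1"
  shows "\<bar>f (boost_mom c j t x)\<bar> \<le> C * exp k * energy c x powr (- k)"
proof -
  have "exp (- 1) * energy c x \<le> exp (- \<bar>t\<bar>) * energy c x"
    using t energy_pos[OF c, of x] by (intro mult_right_mono) auto
  also have "\<dots> \<le> energy c (boost_mom c j t x)" by (rule energy_boost_mom_ge[OF c])
  finally have "energy c (boost_mom c j t x) powr (- k) \<le> (exp (- 1) * energy c x) powr (- k)"
    using energy_pos[OF c, of x] k by (intro powr_mono2') auto
  also have "\<dots> = exp k * energy c x powr (- k)"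
    by (simp add: powr_mult exp_powr_real)
  finally have "C * energy c (boost_mom c j t x) powr (- k) \<le> C * (exp k * energy c x powr (- k))"
    using C by (rule mult_left_mono)
  moreover have "\<bar>f (boost_mom c j t x)\<bar> \<le> C * energy c (boost_mom c j t x) powr (- k)"
    using f by (simp add: energy_decay_def)
  ultimately show ?thesis by (simp add: mult.assoc)
qed

section \<open>The collision operator at a boosted momentum\<close>

text \<open>
  The integrand of \<open>v\<^sub>0 Q(h,f)\<close> at \<open>v\<close>, with \<open>h\<close> and \<open>f\<close> evaluated at boosted momenta. It is a function
  of the pair \<open>(w,\<omega>)\<close>, so that dominated convergence is applied once, on the product measure.
\<close>

definition boosted_integrand ::
  "real \<Rightarrow> real \<Rightarrow> (real \<Rightarrow> real) \<Rightarrow> 3 \<Rightarrow> real^3 \<Rightarrow> (real^3 \<Rightarrow> real) \<Rightarrow> (real^3 \<Rightarrow> real) \<Rightarrow> real \<Rightarrow>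
    (real^3) \<times> (real^3) \<Rightarrow> real" where
  "boosted_integrand c \<gamma> \<sigma> j v h f t = (\<lambda>(w, \<omega>). energy c v * coll_kernel c \<gamma> \<sigma> v w \<omega> *
     (h (boost_mom c j t (post_u c v w \<omega>)) * f (boost_mom c j t (post_v c v w \<omega>))
      - h (boost_mom c j t w) * f (boost_mom c j t v)))"

abbreviation coll_measure :: "((real^3) \<times> (real^3)) measure" where
  "coll_measure \<equiv> lborel \<Otimes>\<^sub>M sphere_measure"

lemma norm_snd_coll_measure: "x \<in> space coll_measure \<Longrightarrow> norm (snd x) = 1"
  by (auto simp: space_pair_measure space_sphere_measure)

interpretation sphere: finite_measure sphere_measure
  by (rule finite_sphere_measure)

interpretation coll: pair_sigma_finite "lborel :: (real^3) measure" sphere_measure ..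

locale collision =
  fixes c \<gamma> :: real and \<sigma> :: "real \<Rightarrow> real"
  assumes c: "c \<ge> 1"
    and \<gamma>: "-2 < \<gamma>" "\<gamma> \<le> 0"
    and \<sigma>_meas: "\<sigma> \<in> borel_measurable (restrict_space borel {0..pi})"
    and \<sigma>_bdd: "bounded (\<sigma> ` {0..pi})"
begin

lemma measurable_boosted_integrand:
  assumes [measurable]: "h \<in> borel_measurable borel" "f \<in> borel_measurable borel"
  shows "boosted_integrand c \<gamma> \<sigma> j v h f t \<in> borel_measurable coll_measure"
proof -
  have [measurable]: "boost_mom c j t \<in> borel \<rightarrow>\<^sub>M borel"
    by (rule measurable_boost_mom[OF c])
  have "(\<lambda>x. coll_kernel c \<gamma> \<sigma> v (fst x) (snd x)) \<in> borel_measurable coll_measure"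
    by (rule measurable_coll_kernel[OF c \<sigma>_meas]) (auto simp: norm_snd_coll_measure)
  moreover have "(\<lambda>x. h (boost_mom c j t (post_u c v (fst x) (snd x))) * f (boost_mom c j t (post_v c v (fst x) (snd x)))
      - h (boost_mom c j t (fst x)) * f (boost_mom c j t v)) \<in> borel_measurable coll_measure"
    by measurable
  ultimately show ?thesis
    unfolding boosted_integrand_def case_prod_beta by (intro borel_measurable_times) auto
qed

text \<open>
  The majorant is uniform in the rapidity and in the pair of functions, because it has to serve both for
  \<open>(v\<^sub>0 \<partial>\<^sub>j h, f)\<close> and for \<open>(h, v\<^sub>0 \<partial>\<^sub>j f)\<close> at all small \<open>t\<close>. In the gain and in the loss term alike,
  one of the two arguments has energy at least \<open>w\<^sub>0 / 2\<close> before the boost.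
\<close>

lemma boosted_integrand_bound:
  assumes k: "k > (\<gamma> + 5) / 2" and C: "0 \<le> C"
  obtains w where "integrable coll_measure w"
    and "\<And>h f t x. energy_decay c k C h \<Longrightarrow> energy_decay c k C f \<Longrightarrow> \<bar>t\<bar> \<le> 1 \<Longrightarrow>
           x \<in> space coll_measure \<Longrightarrow> \<bar>boosted_integrand c \<gamma> \<sigma> j v h f t x\<bar> \<le> w x"
proof -
  obtain S where S: "\<And>\<theta>. \<theta> \<in> {0..pi} \<Longrightarrow> \<bar>\<sigma> \<theta>\<bar> \<le> S"
    using \<sigma>_bdd unfolding bounded_iff by (metis imageI real_norm_def)
  obtain K where K0: "0 \<le> K" and K: "\<And>w \<omega>. norm \<omega> = 1 \<Longrightarrow> \<bar>energy c v * coll_kernel c \<gamma> \<sigma> v w \<omega>\<bar>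
           \<le> K * norm (v - w) powr \<gamma> * energy c w powr (- (\<gamma> / 2 + 1 / 2))"
    by (rule coll_kernel_bound[OF c \<gamma>(2) S, where v = v]) blast+
  have k0: "0 < k" using k \<gamma> by simp
  define L where "L = C * exp k"
  have L0: "0 \<le> L" using C by (simp add: L_def)
  \<comment> \<open>The factor \<open>2\<close> accounts for the gain and the loss term.\<close>
  define A where "A = K * (2 * (L * L * 2 powr k))"
  define G where "G w = A * (norm (v - w) powr \<gamma> * energy c w powr (- (k + (\<gamma> / 2 + 1 / 2))))" for w
  have intG: "integrable lborel G"
    unfolding G_def[abs_def] using k \<gamma>
    by (intro integrable_mult_right integrable_singular_weight[OF c]) auto
  have "integrable coll_measure (\<lambda>x. G (fst x))"
  proof (rule coll.Fubini_integrable)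
    show "(\<lambda>x. G (fst x)) \<in> borel_measurable coll_measure"
      unfolding G_def[abs_def] by measurable
    show "integrable lborel (\<lambda>x. LINT y|sphere_measure. norm (G (fst (x, y))))"
      using intG by simp
    show "AE x in lborel. integrable sphere_measure (\<lambda>y. G (fst (x, y)))"
      by simp
  qed
  moreover have "\<bar>boosted_integrand c \<gamma> \<sigma> j v h f t x\<bar> \<le> G (fst x)"
    if h: "energy_decay c k C h" and f: "energy_decay c k C f" and t: "\<bar>t\<bar> \<le> 1"
      and x: "x \<in> space coll_measure" for h f t x
  proof -
    obtain w \<omega> where x_eq: "x = (w, \<omega>)" by (cases x)
    have \<omega>: "norm \<omega> = 1" using norm_snd_coll_measure[OF x] by (simp add: x_eq)
    let ?B = "boost_mom c j t" and ?V = "post_v c v w \<omega>" and ?U = "post_u c v w \<omega>"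
    have ge1: "1 \<le> energy c y" for y using c_le_energy[of c y] c by linarith
    have le1: "energy c y powr (- k) \<le> 1" for y
      using powr_mono[of "- k" 0 "energy c y"] ge1[of y] k0 by simp
    have dec: "\<bar>h (?B y) * f (?B z)\<bar> \<le> L * L * (2 powr k * energy c w powr (- k))"
      if "energy c w \<le> 2 * energy c y \<or> energy c w \<le> 2 * energy c z" for y z
    proof -
      have half: "energy c q powr (- k) \<le> 2 powr k * energy c w powr (- k)"
        if "energy c w \<le> 2 * energy c q" for q
      proof -
        have "energy c q powr (- k) \<le> (energy c w / 2) powr (- k)"
          using that k0 energy_pos[OF c, of w] by (intro powr_mono2') auto
        also have "\<dots> = 2 powr k * energy c w powr (- k)"
          using energy_pos[OF c, of w] by (simp add: powr_divide powr_minus_divide)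
        finally show ?thesis .
      qed
      have "\<bar>h (?B y) * f (?B z)\<bar> \<le> (L * energy c y powr (- k)) * (L * energy c z powr (- k))"
        unfolding abs_mult L_def using k0 C
        by (intro mult_mono energy_decay_boost[OF c h C _ t] energy_decay_boost[OF c f C _ t]) auto
      also have "\<dots> = L * L * (energy c y powr (- k) * energy c z powr (- k))"
        by (simp only: mult_ac)
      also have "energy c y powr (- k) * energy c z powr (- k) \<le> 2 powr k * energy c w powr (- k)"
        using that
      proof
        assume "energy c w \<le> 2 * energy c y"
        then show ?thesis
          using mult_mono[OF half le1[of z], of y] by simp
      next
        assume "energy c w \<le> 2 * energy c z"
        then show ?thesis
          using mult_mono[OF le1[of y] half, of z] by simp
      qed
      finally show ?thesis using L0 by (simp add: mult_left_mono)
    qed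
    have "energy c w \<le> 2 * energy c ?U \<or> energy c w \<le> 2 * energy c ?V"
      using energy_conservation[OF c \<omega>, of v w] energy_pos[OF c, of v] by linarith
    then have "\<bar>h (?B ?U) * f (?B ?V) - h (?B w) * f (?B v)\<bar>
        \<le> 2 * (L * L * (2 powr k * energy c w powr (- k)))"
      using dec[of ?U ?V] dec[of w v] energy_pos[OF c, of w] by linarith
    then have "\<bar>boosted_integrand c \<gamma> \<sigma> j v h f t x\<bar>
        \<le> (K * norm (v - w) powr \<gamma> * energy c w powr (- (\<gamma> / 2 + 1 / 2)))
           * (2 * (L * L * (2 powr k * energy c w powr (- k))))"
      unfolding x_eq boosted_integrand_def case_prod_conv abs_mult[of "energy c v * coll_kernel c \<gamma> \<sigma> v w \<omega>"]
      using K0 by (intro mult_mono K[OF \<omega>]) auto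
    also have "\<dots> = A * (norm (v - w) powr \<gamma> * (energy c w powr (- (\<gamma> / 2 + 1 / 2)) * energy c w powr (- k)))"
      by (simp add: A_def mult_ac)
    also have "energy c w powr (- (\<gamma> / 2 + 1 / 2)) * energy c w powr (- k) = energy c w powr (- (k + (\<gamma> / 2 + 1 / 2)))"
      by (simp add: powr_add[symmetric] algebra_simps)
    finally show ?thesis by (simp add: x_eq G_def)
  qed
  ultimately show ?thesis by (rule that)
qed

lemma integrable_boosted_integrand:
  assumes "k > (\<gamma> + 5) / 2" "0 \<le> C" "energy_decay c k C h" "energy_decay c k C f" "\<bar>t\<bar> \<le> 1"
    and "h \<in> borel_measurable borel" "f \<in> borel_measurable borel"
  shows "integrable coll_measure (boosted_integrand c \<gamma> \<sigma> j v h f t)"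
proof -
  obtain w where w: "integrable coll_measure w"
    and "\<And>h f t x. energy_decay c k C h \<Longrightarrow> energy_decay c k C f \<Longrightarrow> \<bar>t\<bar> \<le> 1 \<Longrightarrow>
           x \<in> space coll_measure \<Longrightarrow> \<bar>boosted_integrand c \<gamma> \<sigma> j v h f t x\<bar> \<le> w x"
    using boosted_integrand_bound[OF assms(1,2), where j = j and v = v] by metis
  then show ?thesis
    using assms(3-5)
    by (intro Bochner_Integration.integrable_bound[OF w] AE_I2 measurable_boosted_integrand assms(6,7))
       fastforce
qed

text \<open>
  Lorentz covariance of the collision operator: substitute \<open>u = B\<^sub>t w\<close> in the outer integral, and for
  each \<open>w\<close> the Wigner rotation of \<open>\<omega>\<close> in the inner one.
\<close>

lemma coll_op_boost:
  assumes h: "h \<in> borel_measurable borel" and f: "f \<in> borel_measurable borel"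
    and int: "integrable coll_measure (boosted_integrand c \<gamma> \<sigma> j v h f t)"
  shows "energy c (boost_mom c j t v) * coll_op c \<gamma> \<sigma> h f (boost_mom c j t v) =
    (\<integral>x. boosted_integrand c \<gamma> \<sigma> j v h f t x \<partial>coll_measure)"
proof -
  note [measurable] = h f
  let ?B = "boost_mom c j t"
  let ?F = "\<lambda>u \<omega>. coll_kernel c \<gamma> \<sigma> (?B v) u \<omega> *
    (h (post_u c (?B v) u \<omega>) * f (post_v c (?B v) u \<omega>) - h u * f (?B v))"
  define I where "I u = (LINT \<omega>|sphere_measure. ?F u \<omega>)" for u
  have F_meas: "(\<lambda>x. ?F (fst x) (snd x)) \<in> borel_measurable coll_measure"
  proof (rule borel_measurable_times)
    show "(\<lambda>x. coll_kernel c \<gamma> \<sigma> (?B v) (fst x) (snd x)) \<in> borel_measurable coll_measure"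
      by (rule measurable_coll_kernel[OF c \<sigma>_meas]) (auto simp: norm_snd_coll_measure)
    show "(\<lambda>x. h (post_u c (?B v) (fst x) (snd x)) * f (post_v c (?B v) (fst x) (snd x)) - h (fst x) * f (?B v))
        \<in> borel_measurable coll_measure"
      by measurable
  qed
  have I_meas: "I \<in> borel_measurable borel"
    using sphere.borel_measurable_lebesgue_integral[of "\<lambda>u \<omega>. ?F u \<omega>" lborel] F_meas
    by (simp add: I_def[abs_def] case_prod_beta')
  have ev: "0 < energy c (?B v)" by (rule energy_pos[OF c])
  have I_boost: "energy c (?B w) / energy c w * I (?B w) =
      (LINT \<omega>|sphere_measure. boosted_integrand c \<gamma> \<sigma> j v h f t (w, \<omega>)) / energy c (?B v)" for w
  proof -
    have "I (?B w) = (LINT \<omega>|sphere_measure. ?F (?B w) (wigner c j t v w \<omega>))"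
      unfolding I_def
    proof (rule integral_sphere_measure_orthogonal[OF orthogonal_wigner[OF c], symmetric])
      have "(\<lambda>\<omega>. (?B w, \<omega>)) \<in> sphere_measure \<rightarrow>\<^sub>M coll_measure" by measurable
      from measurable_compose[OF this F_meas]
      show "(\<lambda>\<omega>. ?F (?B w) \<omega>) \<in> borel_measurable sphere_measure" by simp
    qed
    then have "energy c (?B v) * (energy c (?B w) / energy c w * I (?B w)) =
        (LINT \<omega>|sphere_measure. energy c (?B v) * (energy c (?B w) / energy c w) * ?F (?B w) (wigner c j t v w \<omega>))"
      by (simp add: mult.assoc)
    also have "\<dots> = (LINT \<omega>|sphere_measure. boosted_integrand c \<gamma> \<sigma> j v h f t (w, \<omega>))"
    proof (rule Bochner_Integration.integral_cong[OF refl])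
      fix \<omega> assume "\<omega> \<in> space sphere_measure"
      then have \<omega>: "norm \<omega> = 1" by (rule norm_sphere_measure)
      \<comment> \<open>The energies produced by the Jacobian and by the prefactor compensate the only
        non-invariant factor of the kernel.\<close>
      have "energy c (?B v) * (energy c (?B w) / energy c w) * coll_kernel c \<gamma> \<sigma> (?B v) (?B w) (wigner c j t v w \<omega>)
          = energy c v * coll_kernel c \<gamma> \<sigma> v w \<omega>"
        using coll_kernel_boost[OF c \<omega>, of j t v w \<gamma> \<sigma>] energy_pos[OF c, of w]
        by (simp add: field_simps)
      then show "energy c (?B v) * (energy c (?B w) / energy c w) * ?F (?B w) (wigner c j t v w \<omega>) =
          boosted_integrand c \<gamma> \<sigma> j v h f t (w, \<omega>)"
        unfolding boosted_integrand_def case_prod_conv post_v_boost[OF c \<omega>] post_u_boost[OF c \<omega>]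
        by (metis mult.assoc)
    qed
    finally show ?thesis using ev by (simp add: field_simps)
  qed
  have "coll_op c \<gamma> \<sigma> h f (?B v) = (LINT u|lborel. I u)"
    by (simp add: coll_op_def I_def)
  also have "\<dots> = (LINT w|lborel. \<bar>det (matrix (\<lambda>y. y + (boost_grad c j t w \<bullet> y) *\<^sub>R axis j 1))\<bar> * I (?B w))"
  proof (rule lborel_change_of_variables)
    show "(?B has_derivative (\<lambda>y. y + (boost_grad c j t w \<bullet> y) *\<^sub>R axis j 1)) (at w)" for w
      by (rule has_derivative_boost_mom[OF c])
    show "bij ?B" by (rule bij_boost_mom[OF c])
    show "I \<in> borel_measurable borel" by (rule I_meas)
    have "integrable lborel (\<lambda>w. (LINT \<omega>|sphere_measure. boosted_integrand c \<gamma> \<sigma> j v h f t (w, \<omega>)) / energy c (?B v))"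
      by (intro integrable_divide_zero impI coll.integrable_fst'[OF int])
    then show "integrable lborel (\<lambda>w. \<bar>det (matrix (\<lambda>y. y + (boost_grad c j t w \<bullet> y) *\<^sub>R axis j 1))\<bar> * I (?B w))"
      using energy_pos[OF c] by (simp add: det_boost_mom[OF c] I_boost[symmetric] less_imp_le)
  qed
  also have "\<dots> = (LINT w|lborel. (LINT \<omega>|sphere_measure. boosted_integrand c \<gamma> \<sigma> j v h f t (w, \<omega>)) / energy c (?B v))"
    using energy_pos[OF c] by (simp add: det_boost_mom[OF c] I_boost[symmetric] less_imp_le)
  also have "\<dots> = (\<integral>x. boosted_integrand c \<gamma> \<sigma> j v h f t x \<partial>coll_measure) / energy c (?B v)"
    by (simp add: coll.integral_fst'[OF int])
  finally show ?thesis using ev by simp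
qed

end

section \<open>The commutation formula\<close>

lemma smooth_differentiable: "smooth f \<Longrightarrow> f differentiable (at x)"
  unfolding smooth_def by (metis C_k.simps(2))

lemma smooth_borel: "smooth f \<Longrightarrow> f \<in> borel_measurable borel"
  unfolding smooth_def by (metis C_k.simps(1) borel_measurable_continuous_onI)

lemma smooth_partial: "smooth f \<Longrightarrow> smooth (partial i f)"
  unfolding smooth_def by (metis C_k.simps(2))

lemma has_derivative_axis:
  assumes "(f has_derivative D) (at x)"
  shows "D (axis j 1) = partial j f x"
proof -
  have "((\<lambda>t. f (x + t *\<^sub>R axis j 1)) has_derivative (\<lambda>t. D (t *\<^sub>R axis j 1))) (at 0)"
    by (rule has_derivative_compose[where g = f and f = "\<lambda>t. x + t *\<^sub>R axis j 1"])
       (use assms in \<open>auto intro!: derivative_eq_intros\<close>)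
  moreover have "D (t *\<^sub>R axis j 1) = D (axis j 1) * t" for t
    using assms by (simp add: has_derivative_linear linear_cmul)
  ultimately have "((\<lambda>t. f (x + t *\<^sub>R axis j 1)) has_real_derivative D (axis j 1)) (at 0)"
    by (simp add: has_field_derivative_def)
  then show ?thesis by (simp add: partial_def DERIV_imp_deriv)
qed

lemma has_derivative_along_boost:
  assumes c: "c \<ge> 1" and f: "f differentiable (at (boost_mom c j t x))"
  shows "((\<lambda>t. f (boost_mom c j t x)) has_real_derivative
      energy c (boost_mom c j t x) * partial j f (boost_mom c j t x)) (at t)"
proof -
  obtain D where D: "(f has_derivative D) (at (boost_mom c j t x))"
    using f by (auto simp: differentiable_def)
  have "((\<lambda>t. f (boost_mom c j t x)) has_vector_derivative
      D (energy c (boost_mom c j t x) *\<^sub>R axis j 1)) (at t)"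
    using vector_derivative_diff_chain_within[OF boost_mom_has_vector_derivative[OF c] has_derivative_at_withinI[OF D]]
    by (simp add: o_def)
  then show ?thesis
    using has_derivative_axis[OF D, of j] D
    by (simp add: has_real_derivative_iff_has_vector_derivative has_derivative_linear linear_cmul)
qed

text \<open>
  With \<open>\<mu>\<^sup>2 = v\<^sub>0\<^sup>2 - v\<^sub>j\<^sup>2\<close>, the orbit of \<open>v\<close> under the boosts has \<open>j\<close>-th component \<open>\<mu> sinh (b + t)\<close> and
  energy \<open>\<mu> cosh (b + t)\<close>, where \<open>\<mu> sinh b = v\<^sub>j\<close>. So the rapidity that shifts this component by
  \<open>\<tau>\<close> is a difference of inverse hyperbolic sines.
\<close>

lemma translate_eq_boost:
  fixes v :: "real^3" and T :: "real \<Rightarrow> real"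
  assumes c: "c \<ge> 1"
    and \<mu>_def: "\<mu> = sqrt ((energy c v)\<^sup>2 - (v $ j)\<^sup>2)"
    and T_def: "\<And>\<tau>. T \<tau> = arsinh ((v $ j + \<tau>) / \<mu>) - arsinh (v $ j / \<mu>)"
  shows "v + \<tau> *\<^sub>R axis j 1 = boost_mom c j (T \<tau>) v"
    and "(T has_real_derivative 1 / energy c v) (at 0)"
    and "T 0 = 0"
proof -
  \<comment> \<open>Positivity of the mass makes the orbit a genuine branch of a hyperbola, \<open>\<mu> > 0\<close>.\<close>
  have "\<bar>v $ j\<bar> < energy c v"
    using component_le_norm_cart[of v j] norm_less_energy[OF c, of v] by linarith
  then have "(v $ j)\<^sup>2 < (energy c v)\<^sup>2"
    using power_strict_mono[of "\<bar>v $ j\<bar>" "energy c v" 2] by simp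
  then have \<mu>: "0 < \<mu>" "\<mu>\<^sup>2 = (energy c v)\<^sup>2 - (v $ j)\<^sup>2"
    by (simp_all add: \<mu>_def)
  define a b where "a = arsinh ((v $ j + \<tau>) / \<mu>)" and "b = arsinh (v $ j / \<mu>)"
  have sb: "\<mu> * sinh b = v $ j" using \<mu> by (simp add: b_def)
  have root: "sqrt ((v $ j / \<mu>)\<^sup>2 + 1) = energy c v / \<mu>"
  proof (rule real_sqrt_unique)
    have "(v $ j / \<mu>)\<^sup>2 + 1 = ((v $ j)\<^sup>2 + \<mu>\<^sup>2) / \<mu>\<^sup>2"
      using \<mu>(1) by (simp add: power_divide add_divide_distrib)
    then show "(energy c v / \<mu>)\<^sup>2 = (v $ j / \<mu>)\<^sup>2 + 1"
      by (simp add: power_divide \<mu>(2))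
  qed (use \<mu> energy_pos[OF c, of v] in simp)
  then have cb: "\<mu> * cosh b = energy c v"
    using \<mu> by (simp add: b_def cosh_arsinh_real)
  have "v $ j + \<tau> = \<mu> * sinh a" using \<mu> by (simp add: a_def)
  also have "\<dots> = \<mu> * sinh ((a - b) + b)" by simp
  also have "\<dots> = sinh (a - b) * (\<mu> * cosh b) + cosh (a - b) * (\<mu> * sinh b)"
    by (subst sinh_add) (simp add: algebra_simps)
  finally have "(cosh (a - b) - 1) * v $ j + sinh (a - b) * energy c v = \<tau>"
    by (simp add: sb cb algebra_simps)
  then show "v + \<tau> *\<^sub>R axis j 1 = boost_mom c j (T \<tau>) v"
    by (simp add: boost_mom_eq[OF c] T_def a_def b_def)
  show "T 0 = 0" by (simp add: T_def)
  have "((\<lambda>\<tau>. arsinh ((v $ j + \<tau>) / \<mu>)) has_real_derivative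
      1 / sqrt (((v $ j + 0) / \<mu>)\<^sup>2 + 1) * (1 / \<mu>)) (at 0)"
    by (rule DERIV_chain2[OF arsinh_real_has_field_derivative])
       (use \<mu>(1) in \<open>auto intro!: derivative_eq_intros\<close>)
  then have "(T has_real_derivative 1 / sqrt (((v $ j + 0) / \<mu>)\<^sup>2 + 1) * (1 / \<mu>) - 0) (at 0)"
    unfolding T_def[abs_def] by (intro DERIV_diff DERIV_const)
  then show "(T has_real_derivative 1 / energy c v) (at 0)"
    using \<mu>(1) by (simp add: root)
qed

theorem theorem1p2:
  fixes c \<gamma> :: real and \<sigma>\<^sub>0 :: "real \<Rightarrow> real" and h f :: "real^3 \<Rightarrow> real" and j :: 3 and v :: "real^3"
  assumes "c \<ge> 1"
    and "-2 < \<gamma>" and "\<gamma> \<le> 0"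
    and "\<sigma>\<^sub>0 \<in> borel_measurable (restrict_space borel {0..pi})"
    and "\<And>\<theta>. \<theta> \<in> {0..pi} \<Longrightarrow> 0 \<le> \<sigma>\<^sub>0 \<theta>"
    and "bounded (\<sigma>\<^sub>0 ` {0..pi})"
    and "smooth h" and "smooth f"
    and "decays \<gamma> h" and "decays \<gamma> f"
    and "\<And>i. decays \<gamma> (\<lambda>w. energy c w * partial i h w)"
    and "\<And>i. decays \<gamma> (\<lambda>w. energy c w * partial i f w)"
  shows "((\<lambda>t. coll_op c \<gamma> \<sigma>\<^sub>0 h f (v + t *\<^sub>R axis j 1)) has_real_derivative
           1 / energy c v * coll_op c \<gamma> \<sigma>\<^sub>0 h (\<lambda>w. energy c w * partial j f w) v
         + 1 / energy c v * coll_op c \<gamma> \<sigma>\<^sub>0 (\<lambda>w. energy c w * partial j h w) f v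
         - v $ j / (energy c v)\<^sup>2 * coll_op c \<gamma> \<sigma>\<^sub>0 h f v) (at 0)"
proof -
  interpret collision c \<gamma> \<sigma>\<^sub>0
    using assms(1-4,6) by unfold_locales
  define Dh Df where "Dh = (\<lambda>w. energy c w * partial j h w)" and "Df = (\<lambda>w. energy c w * partial j f w)"
  note [measurable] = smooth_borel[OF assms(7)] smooth_borel[OF assms(8)]
    smooth_borel[OF smooth_partial[OF assms(7)]] smooth_borel[OF smooth_partial[OF assms(8)]]
  have meas [measurable]: "h \<in> borel_measurable borel" "f \<in> borel_measurable borel"
      "Dh \<in> borel_measurable borel" "Df \<in> borel_measurable borel"
    unfolding Dh_def Df_def by measurable
  have "decays \<gamma> h" "decays \<gamma> f" "decays \<gamma> Dh" "decays \<gamma> Df"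
    using assms(9-12) by (simp_all add: Dh_def Df_def)
  moreover have "-5 < \<gamma>" using \<gamma> by simp
  ultimately obtain k1 k2 k3 k4 C1 C2 C3 C4 where
    ks: "k1 > (\<gamma> + 5) / 2" "k2 > (\<gamma> + 5) / 2" "k3 > (\<gamma> + 5) / 2" "k4 > (\<gamma> + 5) / 2"
    and ds: "energy_decay c k1 C1 h" "energy_decay c k2 C2 f" "energy_decay c k3 C3 Dh" "energy_decay c k4 C4 Df"
    using decays_imp_energy_decay[OF c, of \<gamma>] by metis
  \<comment> \<open>One exponent and one constant for all four functions, so that a single majorant suffices.\<close>
  define k C where "k = min (min k1 k2) (min k3 k4)" and "C = max 0 (max (max C1 C2) (max C3 C4))"
  have k: "k > (\<gamma> + 5) / 2" using ks by (simp add: k_def)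
  have C: "0 \<le> C" by (simp add: C_def)
  have dec: "energy_decay c k C h" "energy_decay c k C f" "energy_decay c k C Dh" "energy_decay c k C Df"
    by (rule energy_decay_weaken[OF c ds(1)] energy_decay_weaken[OF c ds(2)]
        energy_decay_weaken[OF c ds(3)] energy_decay_weaken[OF c ds(4)]; simp add: k_def C_def)+
  obtain W where W: "integrable coll_measure W"
    and bound: "\<And>h f t x. energy_decay c k C h \<Longrightarrow> energy_decay c k C f \<Longrightarrow> \<bar>t\<bar> \<le> 1 \<Longrightarrow>
           x \<in> space coll_measure \<Longrightarrow> \<bar>boosted_integrand c \<gamma> \<sigma>\<^sub>0 j v h f t x\<bar> \<le> W x"
    using boosted_integrand_bound[OF k C, where j = j and v = v] by metis
  let ?G = "boosted_integrand c \<gamma> \<sigma>\<^sub>0 j v"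
  let ?G' = "\<lambda>t x. ?G Dh f t x + ?G h Df t x"
  note int = integrable_boosted_integrand[OF k C, where j = j and v = v]
  have G_der: "((\<lambda>t. ?G h f t x) has_real_derivative ?G' t x) (at t)" for t x
  proof -
    have dh: "((\<lambda>t. h (boost_mom c j t y)) has_real_derivative Dh (boost_mom c j t y)) (at t)" for y
      using has_derivative_along_boost[OF c smooth_differentiable[OF assms(7)]] by (simp add: Dh_def)
    have df: "((\<lambda>t. f (boost_mom c j t y)) has_real_derivative Df (boost_mom c j t y)) (at t)" for y
      using has_derivative_along_boost[OF c smooth_differentiable[OF assms(8)]] by (simp add: Df_def)
    show ?thesis
      unfolding boosted_integrand_def case_prod_beta
      by (rule derivative_eq_intros dh df refl)+ (simp add: algebra_simps)
  qed
  \<comment> \<open>The value of \<open>v\<^sub>0 Q(h,f)\<close> along the orbit of \<open>v\<close> under the boosts; it remains to pass from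
    the rapidity to a translation along the axis and to divide by the energy.\<close>
  define F where "F t = energy c (boost_mom c j t v) * coll_op c \<gamma> \<sigma>\<^sub>0 h f (boost_mom c j t v)" for t
  define F' where "F' = energy c v * coll_op c \<gamma> \<sigma>\<^sub>0 Dh f v + energy c v * coll_op c \<gamma> \<sigma>\<^sub>0 h Df v"
  have at_0: "(\<integral>x. ?G' 0 x \<partial>coll_measure) = F'"
    using coll_op_boost[OF meas(3,2) int[OF dec(3,2) _ meas(3,2)], of 0]
      coll_op_boost[OF meas(1,4) int[OF dec(1,4) _ meas(1,4)], of 0]
      int[OF dec(3,2) _ meas(3,2), of 0] int[OF dec(1,4) _ meas(1,4), of 0]
    by (simp add: F'_def boost_mom_0[OF c])
  have "((\<lambda>t. \<integral>x. ?G h f t x \<partial>coll_measure) has_real_derivative (\<integral>x. ?G' 0 x \<partial>coll_measure)) (at 0)"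
  proof (rule has_real_derivative_lebesgue_integral[where r = 1 and w = "\<lambda>x. W x + W x"])
    show "integrable coll_measure (?G h f t)" if "\<bar>t - 0\<bar> < 1" for t
      using that by (intro int dec meas) simp
    show "?G' 0 \<in> borel_measurable coll_measure"
      by (intro borel_measurable_add measurable_boosted_integrand meas)
    show "\<bar>?G' t x\<bar> \<le> W x + W x" if "\<bar>t - 0\<bar> < 1" "x \<in> space coll_measure" for t x
      using bound[OF dec(3,2) _ that(2), of t] bound[OF dec(1,4) _ that(2), of t] that(1) by linarith
  qed (use W G_der in auto)
  moreover have "\<forall>\<^sub>F t in nhds 0. F t = (\<integral>x. ?G h f t x \<partial>coll_measure)"
  proof (rule eventually_nhds_in_open[of "{-1<..<1::real}" 0, THEN eventually_mono])
    fix t :: real assume "t \<in> {-1<..<1}"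
    then show "F t = (\<integral>x. ?G h f t x \<partial>coll_measure)"
      unfolding F_def by (intro coll_op_boost meas int dec) auto
  qed auto
  ultimately have F_der: "(F has_real_derivative F') (at 0)"
    by (subst DERIV_cong_ev[OF refl _ refl]) (simp_all add: at_0)
  define \<mu> where "\<mu> = sqrt ((energy c v)\<^sup>2 - (v $ j)\<^sup>2)"
  define T where "T \<tau> = arsinh ((v $ j + \<tau>) / \<mu>) - arsinh (v $ j / \<mu>)" for \<tau>
  note T = translate_eq_boost[OF c \<mu>_def T_def]
  have "((\<lambda>\<tau>. F (T \<tau>)) has_real_derivative F' * (1 / energy c v)) (at 0)"
    using DERIV_chain2[of F F' T 0 "1 / energy c v" UNIV] F_der T(2,3) by simp
  moreover have "((\<lambda>\<tau>. energy c (v + \<tau> *\<^sub>R axis j 1)) has_real_derivative v $ j / energy c v) (at 0)"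
  proof -
    have "((\<lambda>\<tau>. energy c (v + \<tau> *\<^sub>R axis j 1)) has_derivative (\<lambda>\<tau>. (v \<bullet> (\<tau> *\<^sub>R axis j 1)) / energy c v)) (at 0)"
      by (rule has_derivative_compose[where g = "energy c" and f = "\<lambda>t. v + t *\<^sub>R axis j 1"])
         (use has_derivative_energy[OF c, of v] in \<open>auto intro!: derivative_eq_intros\<close>)
    then show ?thesis
      unfolding has_field_derivative_def
      by (rule has_derivative_eq_rhs) (simp add: fun_eq_iff inner_axis)
  qed
  ultimately have "((\<lambda>\<tau>. F (T \<tau>) / energy c (v + \<tau> *\<^sub>R axis j 1)) has_real_derivative
      (F' * (1 / energy c v) * energy c v - F 0 * (v $ j / energy c v)) / (energy c v * energy c v)) (at 0)"
    using DERIV_divide[of "\<lambda>\<tau>. F (T \<tau>)" _ 0 UNIV "\<lambda>\<tau>. energy c (v + \<tau> *\<^sub>R axis j 1)"] energy_pos[OF c, of v] T(3)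
    by fastforce
  moreover have "F (T \<tau>) / energy c (v + \<tau> *\<^sub>R axis j 1) = coll_op c \<gamma> \<sigma>\<^sub>0 h f (v + \<tau> *\<^sub>R axis j 1)" for \<tau>
    using energy_pos[OF c, of "boost_mom c j (T \<tau>) v"] by (simp add: F_def T(1))
  moreover have "(F' * (1 / energy c v) * energy c v - F 0 * (v $ j / energy c v)) / (energy c v * energy c v) =
      1 / energy c v * coll_op c \<gamma> \<sigma>\<^sub>0 h Df v + 1 / energy c v * coll_op c \<gamma> \<sigma>\<^sub>0 Dh f v
      - v $ j / (energy c v)\<^sup>2 * coll_op c \<gamma> \<sigma>\<^sub>0 h f v"
    using energy_pos[OF c, of v]
    by (simp add: F'_def F_def boost_mom_0[OF c] field_simps power2_eq_square)
  ultimately show ?thesis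
    unfolding Dh_def Df_def by simp
qed

end
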